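(* Suppose $p(a,x)\in\mathbb R\langle a,x\rangle$ is a symmetric polynomial and $\mathcal U=(\mathcal U_n)_n$ is a nonempty open domain in $\mathbb S(\mathbb R^g)$. If $p(a,x)$ is convex in $x$ on the product domain $\mathbb S(\mathbb R^g)\times\mathcal U$, then $$p(a,x)=L(a,x)+\Lambda(a,x)^T\Lambda(a,x),$$ where (i) $\Lambda(a,x)$ is a (finite) column vector of polynomials which is linear (homogeneous of degree one) in $x$; and (ii) $L(a,x)$ is a polynomial of degree at most one in $x$. Consequently, $p$ has degree at most two in $x$ and is globally convex in $x$, that is, $tp(A,X)+(1-t)p(A,Y)\succeq p(A,tX+(1-t)Y)$ for all $n$, all $A,X,Y\in\mathbb S_n(\mathbb R^g)$ and all $0<t<1$.
   Context: Fix a positive integer $g$. $\mathbb R\langle a,x\rangle$ denotes the polynomials with real coefficients in the non-commuting variables $a=(a_1,\dots,a_g)$, $x=(x_1,\dots,x_g)$. The involution ${}^T$ on $\mathbb R\langle a,x\rangle$ is linear, reverses the order of words, and fixes each variable; $p$ is symmetric if $p^T=p$. For a column vector $\Lambda$ of polynomials $\Lambda_j$, $\Lambda^T\Lambda=\sum_j\Lambda_j^T\Lambda_j$. $\mathbb S_n$ is the space of real symmetric $n\times n$ matrices, $\mathbb S_n(\mathbb R^g)$ is the set of $g$-tuples from $\mathbb S_n$. Polynomials are evaluated at $(A,X)$, $A,X\in\mathbb S_n(\mathbb R^g)$, by substitution. $P\succeq 0$ means $P$ is symmetric positive semidefinite, and $P\succeq Q$ means $P-Q\succeq0$. $\mathbb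 S(\mathbb R^g)=(\mathbb S_n(\mathbb R^g))_n$. A domain $\mathcal D=(\mathcal D_n)_n$ in $\mathbb S(\mathbb R^g)$ is a sequence of subsets $\mathcal D_n\subset\mathbb S_n(\mathbb R^g)$ closed under direct sums: $D_1\in\mathcal D_{n_1}$ and $D_2\in\mathcal D_{n_2}$ imply $D_1\oplus D_2\in\mathcal D_{n_1+n_2}$. It is nonempty if some $\mathcal D_n$ is nonempty, and open if each $\mathcal D_n$ is open. Products are taken levelwise: $\mathcal U\times\mathcal V=(\mathcal U_n\times\mathcal V_n)_n$. A symmetric polynomial $p(a,x)$ is convex in $x$ on $\mathcal W=(\mathcal W_n)_n$ (with $\mathcal W_n\subset\mathbb S_n(\mathbb R^g)\times\mathbb S_n(\mathbb R^g)$) if for each $n$ and all $(A,X),(A,Y)\in\mathcal W_n$ such that $t(A,X)+(1-t)(A,Y)\in\mathcal W_n$ for every $0\le t\le 1$, one has $tp(A,X)+(1-t)p(A,Y)\succeq p(A,tX+(1-t)Y)$ for every $0\le t\le1$. *)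

theory Defs
  imports "HOL-Library.Poly_Mapping" "Jordan_Normal_Form.Matrix"
begin

section \<open>Non-commutative polynomials\<close>

text \<open>Words form a monoid under concatenation, written additively since the product on
  \<open>Poly_Mapping\<close> is the convolution product over an additive monoid of exponents.\<close>

instantiation list :: (type) monoid_add
begin

definition zero_list :: "'a list" where
  "zero_list = []"

definition plus_list :: "'a list \<Rightarrow> 'a list \<Rightarrow> 'a list" where
  "plus_list u v = u @ v"

instance
  by standard (simp_all add: zero_list_def plus_list_def)

end

text \<open>The variables are indexed by a finite type \<open>'g\<close>, so that \<open>g = CARD('g) \<ge> 1\<close>.\<close>

datatype 'g letter = VarA 'g | VarX 'g

type_synonym 'g ncpoly = "'g letter list \<Rightarrow>\<^sub>0 real"

text \<open>Since \<^term>\<open>rev\<close> is its own inverse, the coefficient of \<open>w\<close> in the image of \<open>p\<close> is the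
  coefficient of \<^term>\<open>rev w\<close> in \<open>p\<close>.\<close>

definition involution :: "'g ncpoly \<Rightarrow> 'g ncpoly" where
  "involution p = Poly_Mapping.map_key rev p"

definition symmetric_poly :: "'g ncpoly \<Rightarrow> bool" where
  "symmetric_poly p \<longleftrightarrow> involution p = p"

definition gram :: "'g ncpoly list \<Rightarrow> 'g ncpoly" where
  "gram \<Lambda> = (\<Sum>q\<leftarrow>\<Lambda>. involution q * q)"

primrec is_x :: "'g letter \<Rightarrow> bool" where
  "is_x (VarA j) = False"
| "is_x (VarX j) = True"

definition word_degree_x :: "'g letter list \<Rightarrow> nat" where
  "word_degree_x w = length (filter is_x w)"

text \<open>The zero polynomial is given degree \<open>0\<close>.\<close>

definition degree_x :: "'g ncpoly \<Rightarrow> nat" where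
  "degree_x p = Max (insert 0 (word_degree_x ` Poly_Mapping.keys p))"

definition linear_in_x :: "'g ncpoly \<Rightarrow> bool" where
  "linear_in_x p \<longleftrightarrow> (\<forall>w\<in>Poly_Mapping.keys p. word_degree_x w = 1)"

section \<open>Symmetric matrices and evaluation\<close>

definition sym_mats :: "nat \<Rightarrow> real mat set" where
  "sym_mats n = {M \<in> carrier_mat n n. transpose_mat M = M}"

type_synonym 'g mat_tuple = "'g \<Rightarrow> real mat"

definition sym_tuples :: "nat \<Rightarrow> 'g mat_tuple set" where
  "sym_tuples n = {X. \<forall>j. X j \<in> sym_mats n}"

primrec eval_letter :: "'g mat_tuple \<Rightarrow> 'g mat_tuple \<Rightarrow> 'g letter \<Rightarrow> real mat" where
  "eval_letter A X (VarA j) = A j"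
| "eval_letter A X (VarX j) = X j"

definition eval_word ::
  "nat \<Rightarrow> 'g mat_tuple \<Rightarrow> 'g mat_tuple \<Rightarrow> 'g letter list \<Rightarrow> real mat" where
  "eval_word n A X w = foldr (\<lambda>l M. eval_letter A X l * M) w (1\<^sub>m n)"

text \<open>The sum over the monomials is written entrywise because the type \<^typ>\<open>real mat\<close>, which
  contains matrices of all sizes, has no zero element.\<close>

definition eval_poly ::
  "nat \<Rightarrow> 'g ncpoly \<Rightarrow> 'g mat_tuple \<Rightarrow> 'g mat_tuple \<Rightarrow> real mat" where
  "eval_poly n p A X = mat n n (\<lambda>(r, c).
     \<Sum>w\<in>Poly_Mapping.keys p. Poly_Mapping.lookup p w * eval_word n A X w $$ (r, c))"

definition psd :: "real mat \<Rightarrow> bool" where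
  "psd P \<longleftrightarrow> square_mat P \<and> transpose_mat P = P \<and>
     (\<forall>v\<in>carrier_vec (dim_row P). 0 \<le> v \<bullet> (P *\<^sub>v v))"

definition loewner_ge :: "real mat \<Rightarrow> real mat \<Rightarrow> bool"  (infix \<open>\<succeq>\<close> 50) where
  "P \<succeq> Q \<longleftrightarrow> psd (P - Q)"

definition tuple_comb :: "real \<Rightarrow> 'g mat_tuple \<Rightarrow> 'g mat_tuple \<Rightarrow> 'g mat_tuple" where
  "tuple_comb t X Y = (\<lambda>j. t \<cdot>\<^sub>m X j + (1 - t) \<cdot>\<^sub>m Y j)"

section \<open>Domains and convexity\<close>

text \<open>The levels of a sequence are the sizes \<open>n \<ge> 1\<close>; its value at \<open>0\<close> plays no role. In particular
  the unique \<open>0 \<times> 0\<close> matrix does not make a domain nonempty.\<close>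

definition direct_sum :: "nat \<Rightarrow> nat \<Rightarrow> 'g mat_tuple \<Rightarrow> 'g mat_tuple \<Rightarrow> 'g mat_tuple" where
  "direct_sum m n X Y = (\<lambda>j. four_block_mat (X j) (0\<^sub>m m n) (0\<^sub>m n m) (Y j))"

definition nc_domain :: "(nat \<Rightarrow> 'g mat_tuple set) \<Rightarrow> bool" where
  "nc_domain D \<longleftrightarrow>
     (\<forall>n>0. D n \<subseteq> sym_tuples n) \<and>
     (\<forall>m>0. \<forall>n>0. \<forall>X\<in>D m. \<forall>Y\<in>D n. direct_sum m n X Y \<in> D (m + n))"

definition nonempty_domain :: "(nat \<Rightarrow> 'g mat_tuple set) \<Rightarrow> bool" where
  "nonempty_domain D \<longleftrightarrow> (\<exists>n>0. D n \<noteq> {})"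

text \<open>Openness of each level relative to the finite-dimensional space \<^term>\<open>sym_tuples n\<close>, whose
  topology is given by the maximum of the absolute values of the entries (the index type
  being finite).\<close>

definition open_domain :: "(nat \<Rightarrow> ('g::finite) mat_tuple set) \<Rightarrow> bool" where
  "open_domain D \<longleftrightarrow> (\<forall>n>0. \<forall>X\<in>D n. \<exists>\<epsilon>>0. \<forall>Y\<in>sym_tuples n.
     (\<forall>j. \<forall>r<n. \<forall>c<n. \<bar>Y j $$ (r, c) - X j $$ (r, c)\<bar> < \<epsilon>) \<longrightarrow> Y \<in> D n)"

definition level_product ::
  "(nat \<Rightarrow> 'g mat_tuple set) \<Rightarrow> (nat \<Rightarrow> 'g mat_tuple set) \<Rightarrow> nat \<Rightarrow> ('g mat_tuple \<times> 'g mat_tuple) set"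
where
  "level_product U V = (\<lambda>n. U n \<times> V n)"

definition convex_in_x ::
  "'g ncpoly \<Rightarrow> (nat \<Rightarrow> ('g mat_tuple \<times> 'g mat_tuple) set) \<Rightarrow> bool" where
  "convex_in_x p W \<longleftrightarrow> (\<forall>n>0. \<forall>A X Y. (A, X) \<in> W n \<longrightarrow> (A, Y) \<in> W n \<longrightarrow>
     (\<forall>t\<in>{0..1}. (tuple_comb t A A, tuple_comb t X Y) \<in> W n) \<longrightarrow>
     (\<forall>t\<in>{0..1}. t \<cdot>\<^sub>m eval_poly n p A X + (1 - t) \<cdot>\<^sub>m eval_poly n p A Y
        \<succeq> eval_poly n p A (tuple_comb t X Y)))"

end

theory Submission
  imports Defs "HOL-Analysis.Function_Topology"
begin

text \<open>Convexity near a point of the domain makes second differences of \<open>p\<close> in \<open>x\<close> positive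
  semidefinite. The proof draws two conclusions from this.

  The degree is at most two (\<open>degree_x_le_2_if_convex\<close>). Suppose that the degree is \<open>d \<ge> 3\<close> and let
  \<open>ws\<close> be a longest word among those of degree \<open>d\<close>. Take a path whose edges carry the letters of
  \<open>ws\<close>, and let every variable act by a weighted adjacency matrix of its edges; for the variables
  \<open>x\<close>, this matrix is a small perturbation of a direct sum of copies of a given point of the
  domain. The entries of a word then count walks on the path, and among the words of \<open>p\<close> only \<open>ws\<close>
  leads from the far end to the near end. Reversing the signs of the first two \<open>x\<close>-edges gives a
  second point, and the midpoint of the two points is the path with these edges deleted. The second
  difference has a nonzero entry at the two ends of the path, namely a multiple of the coefficient
  of \<open>ws\<close>. Its diagonal entry at the far end vanishes, because a closed walk from there through the
  second \<open>x\<close>-edge needs degree \<open>2 (d - 1) > d\<close>. A positive semidefinite matrix cannot have both.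

  The part of degree two is a sum of squares (\<open>degree_two_part_sum_of_squares\<close>). In degree at most
  two, second differences do not depend on the base point, so the part of degree two is positive
  semidefinite at all tuples \<open>(A, H)\<close> of the sizes that occur in the domain, and these sizes are
  arbitrarily large. From here on the argument is the one for Helton's theorem on positive
  noncommutative polynomials. If the part of degree two is not a sum of squares, then the residual
  of its best approximation by sums of squares is a functional that is nonnegative on squares and
  negative on \<open>p\<close> (\<open>sum_of_squares_or_separating_functional\<close>). After a small perturbation by a
  strictly positive functional, the Gelfand-Naimark-Segal construction (\<open>truncated_gns\<close>) realises
  it as a vector state \<open>w \<mapsto> \<langle>w e, e\<rangle>\<close> of a tuple of symmetric matrices, at which the part of
  degree two is therefore not positive semidefinite.

  Global convexity follows since the defect of convexity along a segment from \<open>Y\<close> to \<open>X\<close> is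
  \<open>t (1 - t)\<close> times the part of degree two at \<open>(A, X - Y)\<close>, and that part is a sum of squares.\<close>

section \<open>Quadratic forms on finite sets\<close>

definition quad_form :: "'a set \<Rightarrow> ('a \<Rightarrow> 'a \<Rightarrow> real) \<Rightarrow> ('a \<Rightarrow> real) \<Rightarrow> real" where
  "quad_form V G c = (\<Sum>u\<in>V. \<Sum>v\<in>V. c u * c v * G u v)"

lemma quad_form_cong:
  assumes "\<And>u v. u \<in> V \<Longrightarrow> v \<in> V \<Longrightarrow> G u v = G' u v" "\<And>u. u \<in> V \<Longrightarrow> c u = c' u"
  shows "quad_form V G c = quad_form V G' c'"
  unfolding quad_form_def by (intro sum.cong refl) (simp add: assms)

lemma quad_form_insert:
  assumes "finite V" "z \<notin> V" "\<And>v. v \<in> V \<Longrightarrow> G v z = G z v"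
  shows "quad_form (insert z V) G c
    = (c z)\<^sup>2 * G z z + 2 * c z * (\<Sum>v\<in>V. c v * G z v) + quad_form V G c"
proof -
  have "(\<Sum>u\<in>V. c u * c z * G u z) = c z * (\<Sum>v\<in>V. c v * G z v)"
    unfolding sum_distrib_left by (intro sum.cong refl) (simp add: assms(3))
  moreover have "(\<Sum>v\<in>V. c z * c v * G z v) = c z * (\<Sum>v\<in>V. c v * G z v)"
    by (simp add: sum_distrib_left mult.assoc)
  ultimately show ?thesis
    using assms(1,2) by (simp add: quad_form_def sum.distrib power2_eq_square)
qed

text \<open>Otherwise the form would be linear and not constant on the line through the unit vector of \<open>v\<close>
  in the direction of the unit vector of \<open>u\<close>.\<close>

lemma quad_form_nonneg_zero_diagonal:
  assumes "finite V" "u \<in> V" "v \<in> V" "u \<noteq> v" "\<And>x y. x \<in> V \<Longrightarrow> y \<in> V \<Longrightarrow> G x y = G y x"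
    and "\<And>c. 0 \<le> quad_form V G c" "G u u = 0"
  shows "G u v = 0"
proof -
  define T where "T = V - {u, v}"
  have V: "V = insert u (insert v T)" and T: "finite T" "u \<notin> insert v T" "v \<notin> T"
    using assms by (auto simp: T_def)
  have "0 \<le> 2 * a * G u v + G v v" for a
  proof -
    define c where "c = (\<lambda>w. if w = u then a else if w = v then 1 else (0::real))"
    have "quad_form T G c = 0" "(\<Sum>w\<in>T. c w * G u w) = 0" "(\<Sum>w\<in>T. c w * G v w) = 0"
      using T by (auto simp: quad_form_def c_def intro!: sum.neutral)
    then have "quad_form V G c = 2 * a * G u v + G v v"
      unfolding V using T assms(2-5,7)
      by (subst quad_form_insert, simp, simp, simp add: V)+ (simp add: c_def)
    then show ?thesis using assms(6)[of c] by simp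
  qed
  note line = this
  show ?thesis
  proof (rule ccontr)
    assume "G u v \<noteq> 0"
    then have "2 * ((- G v v - 1) / (2 * G u v)) * G u v + G v v = - 1"
      by (simp add: field_simps)
    then show False using line[of "(- G v v - 1) / (2 * G u v)"] by linarith
  qed
qed

text \<open>Completing the square in one variable after the other, as in the Cholesky decomposition.
  A vanishing pivot forces its whole row to vanish.\<close>

lemma gram_factorization:
  fixes G :: "'a \<Rightarrow> 'a \<Rightarrow> real"
  assumes "finite V" "\<And>u v. u \<in> V \<Longrightarrow> v \<in> V \<Longrightarrow> G u v = G v u" "\<And>c. 0 \<le> quad_form V G c"
  shows "\<exists>q. \<forall>u\<in>V. \<forall>v\<in>V. G u v = (\<Sum>i<card V. q i u * q i v)"
  using assms
proof (induction V arbitrary: G rule: finite_induct)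
  case empty
  then show ?case by simp
next
  case (insert z V)
  have sym: "G v z = G z v" if "v \<in> V" for v using insert.prems(1) that by simp
  note exp = quad_form_insert[OF insert.hyps, of G, OF sym]
  have zz: "0 \<le> G z z"
  proof -
    define c where "c = (\<lambda>w. if w = z then 1 else (0::real))"
    have "quad_form V G c = 0" "(\<Sum>w\<in>V. c w * G z w) = 0"
      using insert.hyps by (auto simp: quad_form_def c_def intro!: sum.neutral)
    then show ?thesis using insert.prems(2)[of c] exp[of c] by (simp add: c_def)
  qed
  have row: "G z v = 0" if "v \<in> V" "G z z = 0" for v
    using quad_form_nonneg_zero_diagonal[of "insert z V" z v G] insert that by auto
  define G' where "G' u v = G u v - G z u * G z v / G z z" for u v
  have "0 \<le> quad_form V G' c" for c
  proof -
    define S where "S = (\<Sum>v\<in>V. c v * G z v)"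
    \<comment> \<open>the coordinate at \<open>z\<close> that minimises the form when the others are given by \<open>c\<close>\<close>
    define c' where "c' = c(z := - S / G z z)"
    have c': "c' v = c v" if "v \<in> V" for v using that insert.hyps by (auto simp: c'_def)
    have "quad_form V G' c = quad_form V G c - S\<^sup>2 / G z z"
      by (simp add: quad_form_def G'_def S_def power2_eq_square sum_product sum_subtractf
            right_diff_distrib sum_divide_distrib mult_ac)
    also have "S\<^sup>2 / G z z = - ((c' z)\<^sup>2 * G z z + 2 * c' z * S)"
      using row by (cases "G z z = 0") (auto simp: c'_def field_simps power2_eq_square)
    also have "S = (\<Sum>v\<in>V. c' v * G z v)" by (simp add: S_def c')
    also have "quad_form V G c = quad_form V G c'" by (rule quad_form_cong) (simp_all add: c')
    finally have "quad_form V G' c = quad_form (insert z V) G c'" using exp[of c'] by simp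
    then show ?thesis using insert.prems(2) by simp
  qed
  moreover have "G' u v = G' v u" if "u \<in> V" "v \<in> V" for u v
    using insert.prems(1)[of u v] that by (simp add: G'_def mult.commute)
  ultimately obtain q where q: "\<forall>u\<in>V. \<forall>v\<in>V. G' u v = (\<Sum>i<card V. q i u * q i v)"
    using insert.IH[of G'] by blast
  define q' where "q' i = (if i = card V then (\<lambda>u. G z u / sqrt (G z z)) else (q i)(z := 0))" for i
  have q'_sq: "q' (card V) u * q' (card V) v = G z u * G z v / G z z" for u v
    using zz by (simp add: q'_def)
  have q'_old: "(\<Sum>i<card V. q' i u * q' i v)
      = (if u = z \<or> v = z then 0 else (\<Sum>i<card V. q i u * q i v))" for u v
    by (auto simp: q'_def intro!: sum.cong sum.neutral)
  have "G u v = (\<Sum>i<card (insert z V). q' i u * q' i v)" if "u \<in> insert z V" "v \<in> insert z V" for u v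
  proof -
    have "(\<Sum>i<card (insert z V). q' i u * q' i v)
        = (if u = z \<or> v = z then 0 else G' u v) + G z u * G z v / G z z"
      using insert.hyps q that by (auto simp: q'_old q'_sq)
    then show ?thesis
      using that row sym by (cases "G z z = 0") (auto simp: G'_def)
  qed
  then show ?case by blast
qed

text \<open>The Gram-Schmidt process. If the functions \<open>t i\<close> form an orthonormal basis of \<open>\<real>\<^sup>V\<close> for the
  inner product \<open>M\<close>, then every unit vector \<open>v\<close> is the sum of the \<open>\<langle>v, t i\<rangle> \<cdot> t i\<close>; this completeness
  relation is the only property of the basis that is recorded.\<close>

lemma orthonormal_basis_exists:
  fixes M :: "'a \<Rightarrow> 'a \<Rightarrow> real"
  assumes "finite V" "\<And>u v. u \<in> V \<Longrightarrow> v \<in> V \<Longrightarrow> M u v = M v u"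
    and "\<And>c u. u \<in> V \<Longrightarrow> c u \<noteq> 0 \<Longrightarrow> 0 < quad_form V M c"
  shows "\<exists>t. (\<forall>i u. u \<notin> V \<longrightarrow> t i u = 0) \<and>
    (\<forall>v\<in>V. \<forall>v'\<in>V. (\<Sum>i<card V. t i v' * (\<Sum>u\<in>V. M v u * t i u)) = (if v = v' then 1 else 0))"
  using assms
proof (induction V rule: finite_induct)
  case empty
  show ?case by (rule exI[of _ "\<lambda>_ _. 0"]) simp
next
  case (insert z V)
  have "0 < quad_form V M c" if "u \<in> V" "c u \<noteq> 0" for c u
  proof -
    have "quad_form (insert z V) M (c(z := 0)) = quad_form V M (c(z := 0))"
      using insert.prems(1) insert.hyps by (subst quad_form_insert) auto
    also have "\<dots> = quad_form V M c" using insert.hyps by (intro quad_form_cong) auto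
    finally show ?thesis
      using insert.prems(2)[of u "c(z := 0)"] that insert.hyps by (metis fun_upd_apply insertI2)
  qed
  then obtain t where t0: "\<forall>i u. u \<notin> V \<longrightarrow> t i u = 0" and
    t: "\<forall>v\<in>V. \<forall>v'\<in>V.
      (\<Sum>i<card V. t i v' * (\<Sum>u\<in>V. M v u * t i u)) = (if v = v' then 1 else 0)"
    using insert.IH insert.prems(1) by blast
  define N where "N = card V"
  define b where "b v i = (\<Sum>u\<in>V. M v u * t i u)" for v i
  \<comment> \<open>the unit vector of \<open>z\<close> minus its orthogonal projection to \<open>\<real>\<^sup>V\<close>\<close>
  define o0 where "o0 u = (if u = z then 1 else 0) - (\<Sum>i<N. b z i * t i u)" for u
  have o0_z: "o0 z = 1" using insert.hyps by (simp add: o0_def t0)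
  have o0_out: "o0 u = 0" if "u \<notin> insert z V" for u using that by (simp add: o0_def t0)
  have o0_V: "o0 u = - (\<Sum>i<N. b z i * t i u)" if "u \<in> V" for u
    using that insert.hyps by (auto simp: o0_def)
  have orth: "(\<Sum>u\<in>insert z V. M v u * o0 u) = 0" if "v \<in> V" for v
  proof -
    have "(\<Sum>u\<in>V. M v u * o0 u) = - (\<Sum>i<N. b z i * b v i)"
      by (simp add: o0_V b_def[of v] sum_distrib_left sum_negf mult_ac)
        (subst sum.swap, simp add: mult_ac)
    also have "(\<Sum>i<N. b z i * b v i) = (\<Sum>u\<in>V. M z u * (\<Sum>i<N. t i u * b v i))"
      by (simp add: b_def[of z] sum_distrib_left sum_distrib_right)
        (subst sum.swap, simp add: mult_ac)
    also have "\<dots> = (\<Sum>u\<in>V. if v = u then M z u else 0)"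
      using t that by (intro sum.cong refl) (simp add: b_def N_def)
    also have "\<dots> = M z v" using that insert.hyps by simp
    finally show ?thesis using insert that o0_z by simp
  qed
  define \<alpha> where "\<alpha> = (\<Sum>u\<in>insert z V. M z u * o0 u)"
  have "quad_form (insert z V) M o0 = (\<Sum>v\<in>insert z V. o0 v * (\<Sum>u\<in>insert z V. M v u * o0 u))"
    by (simp only: quad_form_def sum_distrib_left mult_ac)
  also have "\<dots> = \<alpha>" using insert.hyps orth by (simp add: o0_z \<alpha>_def)
  finally have \<alpha>: "0 < \<alpha>" using insert.prems(2)[of z o0] o0_z by simp
  define t' where "t' i = (if i = N then (\<lambda>u. o0 u / sqrt \<alpha>) else t i)" for i
  have b': "(\<Sum>u\<in>insert z V. M v u * t' i u) = b v i" if "i < N" for v i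
    using that insert.hyps by (simp add: t'_def b_def t0)
  have b'_N: "(\<Sum>u\<in>insert z V. M v u * t' N u) = (if v = z then sqrt \<alpha> else 0)"
    if "v \<in> insert z V" for v
  proof -
    have "(\<Sum>u\<in>insert z V. M v u * t' N u) = (\<Sum>u\<in>insert z V. M v u * o0 u) / sqrt \<alpha>"
      unfolding sum_divide_distrib by (intro sum.cong refl) (simp add: t'_def)
    then show ?thesis
      using that orth[of v] \<alpha> by (auto simp: \<alpha>_def[symmetric] real_div_sqrt simp del: sum.insert)
  qed
  have "(\<Sum>i<card (insert z V). t' i v' * (\<Sum>u\<in>insert z V. M v u * t' i u)) = (if v = v' then 1 else 0)"
    if "v \<in> insert z V" "v' \<in> insert z V" for v v'
  proof -
    have "(\<Sum>i<card (insert z V). t' i v' * (\<Sum>u\<in>insert z V. M v u * t' i u))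
        = (\<Sum>i<Suc N. t' i v' * (\<Sum>u\<in>insert z V. M v u * t' i u))"
      by (simp only: card_insert_disjoint[OF insert.hyps] N_def)
    also have "\<dots> = (\<Sum>i<N. t i v' * b v i) + o0 v' / sqrt \<alpha> * (if v = z then sqrt \<alpha> else 0)"
      unfolding sum.lessThan_Suc b'_N[OF that(1)]
      by (intro arg_cong2[of _ _ _ _ "(+)"] sum.cong refl) (simp_all only: b' lessThan_iff, simp_all add: t'_def)
    also have "\<dots> = (\<Sum>i<N. t i v' * b v i) + (if v = z then o0 v' else 0)"
      using \<alpha> by simp
    also have "\<dots> = (if v = v' then 1 else 0)"
    proof (cases "v = z")
      case True
      have "(\<Sum>i<N. t i v' * b z i) + o0 v' = (if v' = z then 1 else 0)"
        by (simp add: o0_def mult.commute)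
      then show ?thesis using True by auto
    next
      case False
      then have "v \<in> V" using that by simp
      then show ?thesis
        using False that t insert.hyps by (cases "v' = z") (auto simp: t0 b_def N_def)
    qed
    finally show ?thesis .
  qed
  moreover have "t' i u = 0" if "u \<notin> insert z V" for i u
    using that by (simp add: t'_def t0 o0_out)
  ultimately show ?case by blast
qed

section \<open>A strictly positive functional\<close>

text \<open>The functional lives on the palindromes of even length \<open>2 m\<close> and has the value \<open>R\<close> to the power \<open>m\<^sup>2\<close> there. On
  a palindrome the weight is thus that of a square \<open>u\<^sup>T u\<close>, and it grows faster than geometrically.\<close>

definition pal_weight :: "real \<Rightarrow> 'a list \<Rightarrow> real" where
  "pal_weight R w = (if \<exists>u. w = rev u @ u then R ^ (length w div 2)\<^sup>2 else 0)"

lemma pal_weight_rev: "pal_weight R (rev w) = pal_weight R w"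
proof -
  have "(\<exists>u. rev w = rev u @ u) = (\<exists>u. w = rev u @ u)"
    by (metis rev_append rev_rev_ident)
  then show ?thesis by (simp add: pal_weight_def)
qed

text \<open>With \<open>m\<close> the mean of the lengths and \<open>d > 0\<close> half their difference, the squares of the lengths
  add up to \<open>2 (m\<^sup>2 + d\<^sup>2)\<close>, so that the geometric mean of the two diagonal terms exceeds the
  off-diagonal one by the factor \<open>R\<close> to the power \<open>d\<^sup>2\<close>.\<close>

lemma pal_weight_offdiag:
  assumes "1 \<le> R" "u \<noteq> v"
  shows "\<bar>c u * c v * pal_weight R (rev u @ v)\<bar>
    \<le> ((c u)\<^sup>2 * R ^ (length u)\<^sup>2 + (c v)\<^sup>2 * R ^ (length v)\<^sup>2) / (2 * R)"
proof (cases "\<exists>t. rev u @ v = rev t @ t")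
  case False
  then show ?thesis using assms by (simp add: pal_weight_def)
next
  case True
  then obtain t where t: "rev u @ v = rev t @ t" by blast
  define a b m where "a = length u" "b = length v" "m = length t"
  have len: "a + b = 2 * m" using arg_cong[OF t, of length] by (simp add: a_b_m_def)
  have "a \<noteq> b"
  proof
    assume "a = b"
    then have "rev u = rev t \<and> v = t" using t len by (simp add: a_b_m_def)
    then show False using assms by simp
  qed
  moreover have "even (a + b)" using len by simp
  ultimately obtain d where d: "d > 0" "a = b + 2 * d \<or> b = a + 2 * d"
    by (metis (no_types, opaque_lifting) add_diff_inverse_nat bot_nat_0.not_eq_extremum dvd_def
        even_diff_nat even_add less_or_eq_imp_le mult_0_right nat_neq_iff not_less add.right_neutral)
  then have sq: "a\<^sup>2 + b\<^sup>2 = 2 * (m\<^sup>2 + d\<^sup>2)"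
  proof -
    have "a = b + 2 * d \<and> m = b + d \<or> b = a + 2 * d \<and> m = a + d" using d len by linarith
    then show ?thesis by (auto simp: power2_eq_square algebra_simps)
  qed
  have R: "pal_weight R (rev u @ v) = R ^ m\<^sup>2"
    using t len by (auto simp: pal_weight_def a_b_m_def)
  define x y where "x = \<bar>c u\<bar> * sqrt (R ^ a\<^sup>2)" "y = \<bar>c v\<bar> * sqrt (R ^ b\<^sup>2)"
  have "sqrt (R ^ a\<^sup>2) * sqrt (R ^ b\<^sup>2) = sqrt ((R ^ (m\<^sup>2 + d\<^sup>2))\<^sup>2)"
    unfolding real_sqrt_mult[symmetric] power_add[symmetric] sq
    by (simp add: power_mult[symmetric] mult.commute)
  then have "x * y = \<bar>c u\<bar> * \<bar>c v\<bar> * (R ^ m\<^sup>2 * R ^ d\<^sup>2)"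
    using assms(1) by (simp add: x_y_def power_add mult_ac)
  moreover have "R \<le> R ^ d\<^sup>2" using assms(1) d(1) by (simp add: self_le_power)
  ultimately have "\<bar>c u\<bar> * \<bar>c v\<bar> * (R ^ m\<^sup>2 * R) \<le> x * y"
    using assms(1) by (simp add: mult_left_mono)
  also have "x * y \<le> (x\<^sup>2 + y\<^sup>2) / 2" using sum_squares_bound[of x y] by simp
  finally have "\<bar>c u\<bar> * \<bar>c v\<bar> * (R ^ m\<^sup>2 * R) \<le> (x\<^sup>2 + y\<^sup>2) / 2" .
  moreover have "x\<^sup>2 = (c u)\<^sup>2 * R ^ a\<^sup>2" "y\<^sup>2 = (c v)\<^sup>2 * R ^ b\<^sup>2"
    using assms(1) by (simp_all add: x_y_def power_mult_distrib)
  ultimately show ?thesis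
    using assms(1) unfolding R a_b_m_def[symmetric] by (simp add: field_simps abs_mult)
qed

text \<open>The matrix of the form is diagonally dominant once its diagonal is normalised: every
  off-diagonal entry is then at most \<open>1 / R\<close>, and there are fewer than \<open>card V\<close> of them in a row.
  Every diagonal entry is at least \<open>1\<close>, whence the lower bound by a multiple of the Euclidean norm.\<close>

lemma pal_weight_strictly_positive:
  assumes "finite V" and R: "R = 2 * real (card V)"
  shows "(\<Sum>u\<in>V. (c u)\<^sup>2) / 2 \<le> quad_form V (\<lambda>u v. pal_weight R (rev u @ v)) c"
proof (cases "V = {}")
  case True
  then show ?thesis by (simp add: quad_form_def)
next
  case False
  then have "1 \<le> card V" using assms(1) by (simp add: Suc_leI card_gt_0_iff)
  then have R1: "1 \<le> R" using R by simp
  define g where "g u = (c u)\<^sup>2 * R ^ (length u)\<^sup>2" for u :: "'a list"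
  have g: "(c u)\<^sup>2 \<le> g u" for u
    using mult_left_mono[OF one_le_power[OF R1], of "(c u)\<^sup>2"] by (simp add: g_def)
  then have g0: "0 \<le> g u" for u using zero_le_power2 order_trans by blast
  have pair: "(if u = v then g u else 0) - (g u + g v) / (2 * R) \<le> c u * c v * pal_weight R (rev u @ v)" for u v
  proof (cases "u = v")
    case True
    have "c u * c u * pal_weight R (rev u @ u) = g u"
      by (auto simp: pal_weight_def g_def power2_eq_square)
    then show ?thesis using True R1 g0 by simp
  next
    case False
    then show ?thesis using pal_weight_offdiag[OF R1 False, of c] by (simp add: g_def)
  qed
  have "(\<Sum>u\<in>V. (c u)\<^sup>2) / 2 \<le> (\<Sum>u\<in>V. g u) / 2" by (simp add: sum_mono g)
  also have "\<dots> = (\<Sum>u\<in>V. g u) - (\<Sum>u\<in>V. \<Sum>v\<in>V. (g u + g v)) / (2 * R)"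
    using R1 by (simp add: sum.distrib R field_simps sum_distrib_left[symmetric] sum_distrib_right[symmetric])
  also have "\<dots> = (\<Sum>u\<in>V. \<Sum>v\<in>V. (if u = v then g u else 0) - (g u + g v) / (2 * R))"
    using assms(1) by (simp add: sum_subtractf sum_divide_distrib)
  also have "\<dots> \<le> quad_form V (\<lambda>u v. pal_weight R (rev u @ v)) c"
    unfolding quad_form_def by (intro sum_mono pair)
  finally show ?thesis .
qed

section \<open>Duality between sums of squares and positive functionals\<close>

definition gram_words :: "'a list set \<Rightarrow> 'a list set" where
  "gram_words V = (\<lambda>(u, v). rev u @ v) ` (V \<times> V)"

text \<open>The coefficient at \<open>w\<close> of the polynomial with the Gram matrix \<open>G\<close>, that is, of the sum of the
  \<open>G u v \<cdot> u\<^sup>T v\<close>.\<close>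

definition gram_coeff :: "'a list set \<Rightarrow> ('a list \<Rightarrow> 'a list \<Rightarrow> real) \<Rightarrow> 'a list \<Rightarrow> real" where
  "gram_coeff V G w = (\<Sum>u\<in>V. \<Sum>v\<in>V. if rev u @ v = w then G u v else 0)"

lemma finite_gram_words [simp]: "finite V \<Longrightarrow> finite (gram_words V)"
  by (simp add: gram_words_def)

lemma rev_in_gram_words_iff: "rev w \<in> gram_words V \<longleftrightarrow> w \<in> gram_words V"
  unfolding gram_words_def image_iff Bex_def split_paired_Ex mem_Times_iff
  by simp (metis rev_append rev_rev_ident)

lemma gram_coeff_outside: "w \<notin> gram_words V \<Longrightarrow> gram_coeff V G w = 0"
  unfolding gram_coeff_def gram_words_def by (intro sum.neutral ballI) auto

lemma gram_coeff_add: "gram_coeff V (\<lambda>u v. G u v + t * D u v) w = gram_coeff V G w + t * gram_coeff V D w"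
  unfolding gram_coeff_def sum_distrib_left sum.distrib[symmetric] by (intro sum.cong refl) simp

lemma gram_coeff_rev:
  assumes "\<And>u v. u \<in> V \<Longrightarrow> v \<in> V \<Longrightarrow> G u v = G v u"
  shows "gram_coeff V G (rev w) = gram_coeff V G w"
proof -
  have "gram_coeff V G (rev w) = (\<Sum>u\<in>V. \<Sum>v\<in>V. if rev v @ u = w then G v u else 0)"
    unfolding gram_coeff_def
    by (intro sum.cong refl if_cong assms) (metis rev_append rev_rev_ident, simp_all)
  also have "\<dots> = gram_coeff V G w" unfolding gram_coeff_def by (rule sum.swap)
  finally show ?thesis .
qed

lemma sum_gram_coeff:
  assumes "finite V"
  shows "(\<Sum>w\<in>gram_words V. f w * gram_coeff V G w) = (\<Sum>u\<in>V. \<Sum>v\<in>V. f (rev u @ v) * G u v)"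
proof -
  have "(\<Sum>w\<in>gram_words V. f w * gram_coeff V G w)
      = (\<Sum>u\<in>V. \<Sum>v\<in>V. \<Sum>w\<in>gram_words V. if rev u @ v = w then f w * G u v else 0)"
    unfolding gram_coeff_def sum_distrib_left
    by (subst sum.swap, rule sum.cong[OF refl], subst sum.swap) (intro sum.cong refl, simp)
  also have "\<dots> = (\<Sum>u\<in>V. \<Sum>v\<in>V. f (rev u @ v) * G u v)"
    using assms by (intro sum.cong refl) (auto simp: gram_words_def)
  finally show ?thesis .
qed

lemma coeff_nonneg_if_quadratic_nonneg:
  fixes a b :: real
  assumes "\<And>t. 0 < t \<Longrightarrow> t < 1 \<Longrightarrow> 0 \<le> 2 * t * a + t\<^sup>2 * b"
  shows "0 \<le> a"
proof (rule ccontr)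
  assume a: "\<not> 0 \<le> a"
  \<comment> \<open>so small that the quadratic term cannot compensate for the linear one\<close>
  define t where "t = min (1/2) (- a / (\<bar>b\<bar> + 1))"
  have b: "0 < \<bar>b\<bar> + 1" by simp
  have "0 < t" "t < 1" "t \<le> - a / (\<bar>b\<bar> + 1)" using a b by (auto simp: t_def divide_neg_pos)
  then have t: "0 < t" "t < 1" "t * (\<bar>b\<bar> + 1) \<le> - a"
    unfolding pos_le_divide_eq[OF b] by auto
  have "t * b \<le> t * (\<bar>b\<bar> + 1)" using t by (intro mult_left_mono) auto
  then have "2 * a + t * b < 0" using a t by linarith
  then have "t * (2 * a + t * b) < 0" using t by (simp add: mult_pos_neg)
  then show False using assms[OF t(1,2)] by (simp add: power2_eq_square algebra_simps)
qed

text \<open>A positive semidefinite Gram matrix is controlled by the polynomial that it represents: the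
  strictly positive functional is at least half the trace on it, and the trace bounds all
  entries. This is what makes the cone of sums of squares closed.\<close>

lemma gram_trace_bound:
  fixes G :: "'a list \<Rightarrow> 'a list \<Rightarrow> real"
  assumes V: "finite V" and sym: "\<And>u v. u \<in> V \<Longrightarrow> v \<in> V \<Longrightarrow> G u v = G v u"
    and psd: "\<And>c. 0 \<le> quad_form V G c" and x: "x \<in> V" "y \<in> V"
  shows "\<bar>G x y\<bar>
    \<le> 2 * (\<Sum>w\<in>gram_words V. pal_weight (2 * real (card V)) w * gram_coeff V G w)"
proof -
  obtain q where q: "\<forall>u\<in>V. \<forall>v\<in>V. G u v = (\<Sum>i<card V. q i u * q i v)"
    using gram_factorization[OF V sym psd] by blast
  have amgm: "\<bar>a * b\<bar> \<le> (a * a + b * b) / 2" for a b :: real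
    using sum_squares_bound[of "\<bar>a\<bar>" "\<bar>b\<bar>"] by (simp add: abs_mult power2_eq_square)
  have diag: "G u u \<le> (\<Sum>u\<in>V. G u u)" if "u \<in> V" for u
    using that V q by (intro member_le_sum) (auto intro!: sum_nonneg)
  have "\<bar>G x y\<bar> \<le> (\<Sum>i<card V. (q i x * q i x + q i y * q i y) / 2)"
    using q x amgm by (auto intro!: order_trans[OF sum_abs] sum_mono)
  also have "\<dots> = (G x x + G y y) / 2"
    using q x by (simp add: sum_divide_distrib[symmetric] sum.distrib)
  also have "\<dots> \<le> (\<Sum>u\<in>V. G u u)" using diag[OF x(1)] diag[OF x(2)] by simp
  also have "\<dots> = 2 * (\<Sum>i<card V. (\<Sum>u\<in>V. (q i u)\<^sup>2) / 2)"
    using q by (simp add: power2_eq_square sum_divide_distrib[symmetric]) (rule sum.swap)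
  also have "\<dots> \<le> 2 * (\<Sum>i<card V. quad_form V (\<lambda>u v. pal_weight (2 * real (card V)) (rev u @ v)) (q i))"
    by (intro mult_left_mono sum_mono pal_weight_strictly_positive V) simp_all
  also have "(\<Sum>i<card V. quad_form V (\<lambda>u v. pal_weight (2 * real (card V)) (rev u @ v)) (q i))
      = (\<Sum>u\<in>V. \<Sum>v\<in>V. pal_weight (2 * real (card V)) (rev u @ v) * G u v)"
  proof -
    have "(\<Sum>u\<in>V. \<Sum>v\<in>V. pal_weight (2 * real (card V)) (rev u @ v) * G u v)
      = (\<Sum>u\<in>V. \<Sum>v\<in>V. \<Sum>i<card V. q i u * q i v * pal_weight (2 * real (card V)) (rev u @ v))"
      using q by (intro sum.cong refl) (simp add: sum_distrib_left sum_distrib_right mult_ac)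
    also have "\<dots> = (\<Sum>u\<in>V. \<Sum>i<card V. \<Sum>v\<in>V. q i u * q i v * pal_weight (2 * real (card V)) (rev u @ v))"
      by (rule sum.cong[OF refl], rule sum.swap)
    also have "\<dots> = (\<Sum>i<card V. quad_form V (\<lambda>u v. pal_weight (2 * real (card V)) (rev u @ v)) (q i))"
      unfolding quad_form_def by (rule sum.swap)
    finally show ?thesis by simp
  qed
  also have "\<dots> = (\<Sum>w\<in>gram_words V. pal_weight (2 * real (card V)) w * gram_coeff V G w)"
    by (rule sum_gram_coeff[OF V, symmetric])
  finally show ?thesis .
qed

lemma compact_Pi_UNIV:
  fixes B :: "'a \<Rightarrow> 'b::topological_space set"
  assumes "\<And>x. compact (B x)"
  shows "compact {f. \<forall>x. f x \<in> B x}"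
proof -
  have "compactin (product_topology (\<lambda>_. euclidean) UNIV) (PiE UNIV B)"
    using assms by (simp add: compactin_PiE)
  moreover have "PiE UNIV B = {f. \<forall>x. f x \<in> B x}" by (auto simp: PiE_def)
  ultimately show ?thesis by (simp add: euclidean_product_topology)
qed

text \<open>Let \<open>G\<close> be a positive semidefinite Gram matrix whose polynomial comes closest to \<open>p\<close>, which exists
  by compactness, and let \<open>l\<close> be the residual, that is, the difference of the two polynomials read as
  a functional. Moving \<open>G\<close> in the direction of a square shows that \<open>l\<close> is nonnegative on squares;
  moving \<open>G\<close> towards \<open>0\<close> shows that \<open>l\<close> is not positive on the approximation. Hence \<open>l\<close> takes at \<open>p\<close>
  at most the value \<open>- \<bar>l\<bar>\<^sup>2\<close>.\<close>

theorem sum_of_squares_or_separating_functional: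
  fixes V :: "'a list set" and p :: "'a list \<Rightarrow> real"
  assumes V: "finite V" and p_rev: "\<And>w. p (rev w) = p w"
  obtains (sum_of_squares) q where
      "\<And>w. w \<in> gram_words V \<Longrightarrow> p w = (\<Sum>i<card V. gram_coeff V (\<lambda>u v. q i u * q i v) w)"
  | (separated) l where "\<And>w. l (rev w) = l w" "\<And>w. w \<notin> gram_words V \<Longrightarrow> l w = 0"
      "\<And>c. 0 \<le> quad_form V (\<lambda>u v. l (rev u @ v)) c" "(\<Sum>w\<in>gram_words V. l w * p w) < 0"
proof -
  define W where "W = gram_words V"
  have W: "finite W" using V by (simp add: W_def)
  define F where "F G = (\<Sum>w\<in>W. (p w - gram_coeff V G w)\<^sup>2)" for G
  define psd where "psd G \<longleftrightarrow> (\<forall>u v. G u v = G v u) \<and> (\<forall>c. 0 \<le> quad_form V G c)"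
    for G :: "'a list \<Rightarrow> 'a list \<Rightarrow> real"
  define B0 where "B0 = sqrt (\<Sum>w\<in>W. (p w)\<^sup>2)"
  define T where "T = 2 * (\<Sum>w\<in>W. \<bar>pal_weight (2 * real (card V)) w\<bar> * (\<bar>p w\<bar> + B0))"
  have bound: "\<bar>G x y\<bar> \<le> T" if "psd G" "F G \<le> F (\<lambda>_ _. 0)" "x \<in> V" "y \<in> V" for G x y
  proof -
    have "F (\<lambda>_ _. 0) = (\<Sum>w\<in>W. (p w)\<^sup>2)" by (simp add: F_def gram_coeff_def)
    moreover have "(p w - gram_coeff V G w)\<^sup>2 \<le> F G" if "w \<in> W" for w
      unfolding F_def using that W by (intro member_le_sum) auto
    ultimately have "\<bar>p w - gram_coeff V G w\<bar> \<le> B0" if "w \<in> W" for w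
      using that \<open>F G \<le> _\<close> unfolding B0_def by (intro real_le_rsqrt) fastforce
    then have coeff: "\<bar>gram_coeff V G w\<bar> \<le> \<bar>p w\<bar> + B0" if "w \<in> W" for w
      using that by fastforce
    have "\<bar>G x y\<bar> \<le> 2 * (\<Sum>w\<in>W. pal_weight (2 * real (card V)) w * gram_coeff V G w)"
      unfolding W_def using gram_trace_bound[OF V, of G x y] that by (simp add: psd_def)
    also have "\<dots> \<le> T"
    proof -
      have "a * gram_coeff V G w \<le> \<bar>a\<bar> * (\<bar>p w\<bar> + B0)" if "w \<in> W" for a w
        by (rule order_trans[OF abs_ge_self]) (simp add: abs_mult mult_left_mono coeff that)
      then show ?thesis unfolding T_def by (intro mult_left_mono sum_mono) simp_all
    qed
    finally show ?thesis .
  qed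
  \<comment> \<open>matrices are uncurried so that they form a single product of copies of \<open>\<real>\<close>\<close>
  define box where "box = (\<lambda>x :: 'a list. \<lambda>y. if x \<in> V \<and> y \<in> V then {-T..T} else {0})"
  define K where "K = {g. \<forall>x. g x \<in> (case x of (u, v) \<Rightarrow> box u v)}"
  define A where "A = K \<inter> {g. psd (curry g)}"
  have "compact K" unfolding K_def by (rule compact_Pi_UNIV) (auto simp: box_def)
  moreover have "closed {g. psd (curry g)}"
    unfolding psd_def quad_form_def curry_def
    by (intro closed_Collect_conj closed_Collect_all closed_Collect_eq closed_Collect_le
        continuous_intros continuous_on_product_coordinates)
  ultimately have "compact A" unfolding A_def by (rule compact_Int_closed)
  moreover have T0: "0 \<le> T"
    unfolding T_def B0_def by (intro mult_nonneg_nonneg sum_nonneg add_nonneg_nonneg) (auto simp: sum_nonneg)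
  have zero_A: "(\<lambda>_. 0) \<in> A"
    using T0 by (auto simp: A_def K_def box_def psd_def quad_form_def)
  moreover have "continuous_on A (\<lambda>g. F (curry g))"
  proof -
    have "continuous_on A (\<lambda>g. if rev u @ v = w then g (u, v) else 0)" for u v w
      by (cases "rev u @ v = w") (auto intro: continuous_on_product_coordinates continuous_on_subset)
    then show ?thesis
      unfolding F_def gram_coeff_def curry_def by (intro continuous_intros)
  qed
  ultimately obtain g where g: "g \<in> A" "\<And>h. h \<in> A \<Longrightarrow> F (curry g) \<le> F (curry h)"
    using continuous_attains_inf[of A] by (metis empty_iff)
  define G where "G = curry g"
  have psd_G: "psd G" and supp_G: "u \<notin> V \<or> v \<notin> V \<Longrightarrow> G u v = 0" for u v
    using g(1) by (auto simp: A_def K_def G_def box_def split: if_splits)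
  \<comment> \<open>a matrix outside the compact set is worse than the zero matrix, by the choice of the box\<close>
  have G_min: "F G \<le> F H" if "psd H" "\<And>u v. u \<notin> V \<or> v \<notin> V \<Longrightarrow> H u v = 0" for H
  proof (cases "F H \<le> F (\<lambda>_ _. 0)")
    case True
    then have "case_prod H \<in> A"
      using that bound[OF that(1) True] by (force simp: A_def K_def box_def abs_le_iff)
    then show ?thesis using g(2)[of "case_prod H"] by (simp add: G_def)
  next
    case False
    then show ?thesis using g(2)[OF zero_A] by (simp add: G_def curry_def)
  qed
  define l where "l w = (if w \<in> W then gram_coeff V G w - p w else 0)" for w
  \<comment> \<open>the derivative of \<open>F\<close> in an admissible direction\<close>
  have dir: "0 \<le> (\<Sum>w\<in>W. l w * gram_coeff V D w)"
    if "\<And>t. 0 < t \<Longrightarrow> t < 1 \<Longrightarrow> psd (\<lambda>u v. G u v + t * D u v)"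
      "\<And>u v. u \<notin> V \<or> v \<notin> V \<Longrightarrow> D u v = 0" for D
  proof (rule coeff_nonneg_if_quadratic_nonneg)
    fix t :: real assume t: "0 < t" "t < 1"
    have "F G \<le> F (\<lambda>u v. G u v + t * D u v)"
      using that t supp_G by (intro G_min) auto
    also have "\<dots> = F G + 2 * t * (\<Sum>w\<in>W. l w * gram_coeff V D w) + t\<^sup>2 * (\<Sum>w\<in>W. (gram_coeff V D w)\<^sup>2)"
      unfolding F_def gram_coeff_add sum_distrib_left sum.distrib[symmetric]
      by (intro sum.cong refl) (simp add: l_def power2_eq_square algebra_simps)
    finally show "0 \<le> 2 * t * (\<Sum>w\<in>W. l w * gram_coeff V D w) + t\<^sup>2 * (\<Sum>w\<in>W. (gram_coeff V D w)\<^sup>2)"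
      by simp
  qed
  have quad_add: "quad_form V (\<lambda>u v. a * G u v + b * D u v) c = a * quad_form V G c + b * quad_form V D c"
    for a b D c
    by (simp add: quad_form_def sum.distrib[symmetric] sum_distrib_left distrib_left mult_ac)
  have l_pos: "0 \<le> quad_form V (\<lambda>u v. l (rev u @ v)) c" for c
  proof -
    define d where "d u = (if u \<in> V then c u else 0)" for u
    have sq: "quad_form V (\<lambda>u v. d u * d v) e = (\<Sum>u\<in>V. e u * d u)\<^sup>2" for e
      by (simp add: quad_form_def power2_eq_square sum_product mult_ac)
    have "psd (\<lambda>u v. G u v + t * (d u * d v))" if "0 < t" for t
      using psd_G quad_add[of 1 t "\<lambda>u v. d u * d v"] that by (simp add: psd_def sq mult.commute)
    then have "0 \<le> (\<Sum>w\<in>W. l w * gram_coeff V (\<lambda>u v. d u * d v) w)"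
      by (intro dir) (auto simp: d_def)
    also have "\<dots> = (\<Sum>u\<in>V. \<Sum>v\<in>V. l (rev u @ v) * (d u * d v))"
      unfolding W_def by (rule sum_gram_coeff[OF V])
    also have "\<dots> = quad_form V (\<lambda>u v. l (rev u @ v)) c"
      unfolding quad_form_def by (intro sum.cong refl) (simp add: d_def mult_ac)
    finally show ?thesis .
  qed
  have "0 \<le> (\<Sum>w\<in>W. l w * gram_coeff V (\<lambda>u v. - G u v) w)"
  proof (rule dir)
    fix t :: real assume "0 < t" "t < 1"
    then show "psd (\<lambda>u v. G u v + t * - G u v)"
      using psd_G quad_add[of 1 "- t" G] by (auto simp: psd_def mult_left_le_one_le)
  qed (use supp_G in auto)
  also have "\<dots> = - (\<Sum>w\<in>W. l w * gram_coeff V G w)"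
  proof -
    have "gram_coeff V (\<lambda>u v. - G u v) w = - gram_coeff V G w" for w
      by (simp add: gram_coeff_def sum_negf[symmetric] if_distrib cong: if_cong)
    then show ?thesis by (simp add: sum_negf)
  qed
  finally have "(\<Sum>w\<in>W. l w * p w) \<le> - (\<Sum>w\<in>W. (l w)\<^sup>2)"
  proof -
    assume "0 \<le> - (\<Sum>w\<in>W. l w * gram_coeff V G w)"
    moreover have "(\<Sum>w\<in>W. l w * gram_coeff V G w) = (\<Sum>w\<in>W. l w * p w) + (\<Sum>w\<in>W. (l w)\<^sup>2)"
      unfolding sum.distrib[symmetric]
      by (intro sum.cong refl) (simp add: l_def power2_eq_square algebra_simps)
    ultimately show ?thesis by linarith
  qed
  note l_p = this
  have l_rev: "l (rev w) = l w" for w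
    using gram_coeff_rev[of V G w] psd_G
    by (simp add: l_def W_def rev_in_gram_words_iff p_rev psd_def)
  show ?thesis
  proof (cases "\<forall>w\<in>W. l w = 0")
    case False
    then have "0 < (\<Sum>w\<in>W. (l w)\<^sup>2)" using W by (auto intro!: sum_pos2)
    then show ?thesis using separated[of l] l_rev l_pos l_p by (auto simp: W_def l_def)
  next
    case True
    obtain q where q: "\<forall>u\<in>V. \<forall>v\<in>V. G u v = (\<Sum>i<card V. q i u * q i v)"
      using gram_factorization[OF V, of G] psd_G unfolding psd_def by blast
    have "p w = (\<Sum>i<card V. gram_coeff V (\<lambda>u v. q i u * q i v) w)" if "w \<in> W" for w
    proof -
      have "p w = gram_coeff V G w" using True that by (simp add: l_def)
      also have "\<dots> = (\<Sum>u\<in>V. \<Sum>v\<in>V. \<Sum>i<card V. if rev u @ v = w then q i u * q i v else 0)"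
        unfolding gram_coeff_def using q by (intro sum.cong refl) auto
      also have "\<dots> = (\<Sum>u\<in>V. \<Sum>i<card V. \<Sum>v\<in>V. if rev u @ v = w then q i u * q i v else 0)"
        by (rule sum.cong[OF refl], rule sum.swap)
      also have "\<dots> = (\<Sum>i<card V. gram_coeff V (\<lambda>u v. q i u * q i v) w)"
        unfolding gram_coeff_def by (rule sum.swap)
      finally show ?thesis .
    qed
    then show ?thesis using sum_of_squares by (simp add: W_def)
  qed
qed

section \<open>Words acting on vectors\<close>

text \<open>Matrices and vectors are functions of which only the values at indices below \<open>n\<close> matter. This
  avoids dimension side conditions in the manipulation of words.\<close>

primrec act :: "nat \<Rightarrow> ('l \<Rightarrow> nat \<Rightarrow> nat \<Rightarrow> real) \<Rightarrow> 'l list \<Rightarrow> (nat \<Rightarrow> real) \<Rightarrow> nat \<Rightarrow> real" where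
  "act n B [] y = y"
| "act n B (l # w) y = (\<lambda>r. \<Sum>c<n. B l r c * act n B w y c)"

lemma act_append: "act n B (u @ w) y = act n B u (act n B w y)"
  by (induction u) simp_all

lemma act_cong:
  assumes "\<And>l r c. l \<in> set w \<Longrightarrow> r < n \<Longrightarrow> c < n \<Longrightarrow> B l r c = B' l r c"
    "\<And>r. r < n \<Longrightarrow> y r = y' r" "r < n"
  shows "act n B w y r = act n B' w y' r"
  using assms by (induction w arbitrary: r) (auto intro!: sum.cong)

lemma act_adjoint:
  assumes "\<And>l r c. r < n \<Longrightarrow> c < n \<Longrightarrow> B l r c = B l c r"
  shows "(\<Sum>r<n. x r * act n B w y r) = (\<Sum>r<n. act n B (rev w) x r * y r)"
proof (induction w arbitrary: x)
  case (Cons l w)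
  have "(\<Sum>r<n. x r * act n B (l # w) y r) = (\<Sum>c<n. \<Sum>r<n. x r * (B l r c * act n B w y c))"
    by (simp add: sum_distrib_left) (rule sum.swap)
  also have "\<dots> = (\<Sum>c<n. act n B [l] x c * act n B w y c)"
    by (intro sum.cong refl) (simp add: sum_distrib_left sum_distrib_right assms mult_ac)
  also have "\<dots> = (\<Sum>r<n. act n B (rev (l # w)) x r * y r)"
    by (simp only: Cons.IH rev.simps(2) act_append)
  finally show ?case .
qed simp

text \<open>The Gelfand-Naimark-Segal construction, truncated to a finite set of words that contains the
  suffixes of its elements. Let \<open>t 0, t 1, \<dots>\<close> be an orthonormal basis of \<open>\<real>\<^sup>V\<close> for the inner
  product \<open>\<langle>u, v\<rangle> = l (rev u @ v)\<close>. The letter \<open>x\<close> acts by the compression of the left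
  multiplication by \<open>x\<close>: its matrix has the entries \<open>\<langle>t r, x t c\<rangle>\<close>, which is symmetric in \<open>r\<close> and
  \<open>c\<close> because \<open>l\<close> is invariant under reversal. As long as no word leaves \<open>V\<close>, the compression is
  left multiplication itself, and so the word \<open>w\<close> maps the vector of the empty word to that of \<open>w\<close>.\<close>

theorem truncated_gns:
  fixes l :: "'a list \<Rightarrow> real"
  assumes V: "finite V" "[] \<in> V" and suffix: "\<And>x w. x # w \<in> V \<Longrightarrow> w \<in> V"
    and l_rev: "\<And>w. l (rev w) = l w"
    and pos: "\<And>c u. u \<in> V \<Longrightarrow> c u \<noteq> 0 \<Longrightarrow> 0 < quad_form V (\<lambda>u v. l (rev u @ v)) c"
    and n: "card V \<le> n"
  obtains B e where "\<And>x r c. B x r c = B x c r"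
    "\<And>w1 w2. rev w1 \<in> V \<Longrightarrow> w2 \<in> V \<Longrightarrow> (\<Sum>r<n. e r * act n B (w1 @ w2) e r) = l (w1 @ w2)"
proof -
  define M where "M u v = l (rev u @ v)" for u v
  have sym: "M u v = M v u" for u v
    using l_rev[of "rev u @ v"] by (simp add: M_def)
  obtain t where t: "\<forall>v\<in>V. \<forall>v'\<in>V.
      (\<Sum>i<card V. t i v' * (\<Sum>u\<in>V. M v u * t i u)) = (if v = v' then 1 else 0)"
    using orthonormal_basis_exists[OF V(1), of M] sym pos unfolding M_def by blast
  \<comment> \<open>padded with zero vectors, so that the size of the matrices can be any \<open>n \<ge> card V\<close>\<close>
  define s where "s i u = (if i < card V then t i u else 0)" for i u
  \<comment> \<open>the coordinates \<open>\<langle>v, s i\<rangle>\<close> of the word \<open>v\<close> in this basis\<close>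
  define b where "b v i = (\<Sum>u\<in>V. M v u * s i u)" for v i
  have complete: "(\<Sum>i<n. s i v' * b v i) = (if v = v' then 1 else 0)" if "v \<in> V" "v' \<in> V" for v v'
  proof -
    have "(\<Sum>i<n. s i v' * b v i) = (\<Sum>i<card V. s i v' * b v i)"
      using n by (intro sum.mono_neutral_right) (auto simp: s_def)
    also have "\<dots> = (\<Sum>i<card V. t i v' * (\<Sum>u\<in>V. M v u * t i u))"
      by (intro sum.cong refl) (simp add: s_def b_def)
    finally show ?thesis using t that by simp
  qed
  define B where "B x r c = (\<Sum>u\<in>V. \<Sum>v\<in>V. s r u * l (rev u @ x # v) * s c v)" for x r c
  have swap: "l (rev u @ x # v) = l (rev v @ x # u)" for u x v
    using l_rev[of "rev u @ x # v"] by simp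
  have B_sym: "B x r c = B x c r" for x r c
    unfolding B_def by (subst sum.swap) (intro sum.cong refl, simp add: swap mult_ac)
  have act_b: "act n B w (b []) r = b w r" if "w \<in> V" for w r
    using that
  proof (induction w arbitrary: r)
    case (Cons x w)
    then have w: "w \<in> V" using suffix by blast
    have "act n B (x # w) (b []) r = (\<Sum>c<n. B x r c * b w c)"
      using Cons.IH[OF w] by simp
    also have "\<dots> = (\<Sum>c<n. \<Sum>u\<in>V. \<Sum>v\<in>V. s r u * l (rev u @ x # v) * (s c v * b w c))"
      by (simp add: B_def sum_distrib_right mult.assoc)
    also have "\<dots> = (\<Sum>u\<in>V. \<Sum>v\<in>V. \<Sum>c<n. s r u * l (rev u @ x # v) * (s c v * b w c))"
      by (subst sum.swap, rule sum.cong[OF refl], rule sum.swap)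
    also have "\<dots> = (\<Sum>u\<in>V. \<Sum>v\<in>V. if w = v then s r u * l (rev u @ x # v) else 0)"
      unfolding sum_distrib_left[symmetric] using complete[OF w] by (intro sum.cong refl) simp
    also have "\<dots> = (\<Sum>u\<in>V. s r u * l (rev u @ x # w))"
      using V w by (intro sum.cong refl) simp
    also have "\<dots> = b (x # w) r"
      unfolding b_def by (intro sum.cong refl) (simp add: swap[of w] M_def)
    finally show ?case .
  qed simp
  have "(\<Sum>r<n. b [] r * act n B (w1 @ w2) (b []) r) = l (w1 @ w2)" if w: "rev w1 \<in> V" "w2 \<in> V" for w1 w2
  proof -
    have "(\<Sum>r<n. b [] r * act n B (w1 @ w2) (b []) r)
        = (\<Sum>r<n. act n B (rev w1) (b []) r * act n B w2 (b []) r)"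
      unfolding act_append by (rule act_adjoint[OF B_sym])
    also have "\<dots> = (\<Sum>r<n. \<Sum>u\<in>V. M (rev w1) u * (s r u * b w2 r))"
      unfolding act_b[OF w(1)] act_b[OF w(2)]
      by (simp add: b_def[of "rev w1"] sum_distrib_right mult.assoc)
    also have "\<dots> = (\<Sum>u\<in>V. M (rev w1) u * (\<Sum>r<n. s r u * b w2 r))"
      unfolding sum_distrib_left by (rule sum.swap)
    also have "\<dots> = (\<Sum>u\<in>V. if w2 = u then M (rev w1) u else 0)"
      using complete[OF w(2)] by (intro sum.cong refl) simp
    also have "\<dots> = l (w1 @ w2)" using V w by (simp add: M_def)
    finally show ?thesis .
  qed
  then show ?thesis using that[of B "b []"] B_sym by blast
qed

section \<open>Words of degree at most two\<close>

lemma word_degree_x_simps [simp]: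
  "word_degree_x [] = 0"
  "word_degree_x (l # w) = (if is_x l then Suc (word_degree_x w) else word_degree_x w)"
  "word_degree_x (u @ w) = word_degree_x u + word_degree_x w"
  "word_degree_x (rev w) = word_degree_x w"
  by (simp_all add: word_degree_x_def rev_filter[symmetric])

lemma act_degree_0:
  assumes "word_degree_x w = 0" "\<And>l r c. \<not> is_x l \<Longrightarrow> r < n \<Longrightarrow> c < n \<Longrightarrow> B l r c = B' l r c" "r < n"
  shows "act n B w y r = act n B' w y r"
  using assms(1) by (intro act_cong assms refl) (auto simp: word_degree_x_def filter_empty_conv)

lemma act_scale:
  assumes "\<And>l r c. r < n \<Longrightarrow> c < n \<Longrightarrow> B' l r c = (if is_x l then s * B l r c else B l r c)" "r < n"
  shows "act n B' w y r = s ^ word_degree_x w * act n B w y r"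
  using assms(2)
proof (induction w arbitrary: r)
  case (Cons l w)
  then show ?case using assms(1) by (simp add: sum_distrib_left mult_ac)
qed simp

text \<open>At the first letter of degree one, the rest of the word has a smaller degree, so that it is
  constant in \<open>x\<close> for a word of degree one and linear for a word of degree two. In the latter case
  the product of two linear combinations with the weights \<open>t\<close> and \<open>1 - t\<close> leaves the factor
  \<open>t (1 - t)\<close> for the product of the differences.\<close>

lemma act_degree_1:
  assumes "word_degree_x w = 1" "r < n"
    and A: "\<And>l r c. \<not> is_x l \<Longrightarrow> r < n \<Longrightarrow> c < n \<Longrightarrow> B1 l r c = B l r c \<and> B2 l r c = B l r c"
    and X: "\<And>l r c. is_x l \<Longrightarrow> r < n \<Longrightarrow> c < n \<Longrightarrow> B l r c = s * B1 l r c + t * B2 l r c"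
  shows "act n B w y r = s * act n B1 w y r + t * act n B2 w y r"
  using assms(1,2)
proof (induction w arbitrary: r)
  case (Cons l w)
  show ?case
  proof (cases "is_x l")
    case True
    then have w: "word_degree_x w = 0" using Cons.prems by simp
    have "act n B1 w y c = act n B w y c" "act n B2 w y c = act n B w y c" if "c < n" for c
      using act_degree_0[OF w _ that] A by (metis (no_types, lifting))+
    then show ?thesis
      using True X Cons.prems by (simp add: sum.distrib[symmetric] sum_distrib_left algebra_simps)
  next
    case False
    then show ?thesis
      using A Cons by (simp add: sum.distrib[symmetric] sum_distrib_left algebra_simps)
  qed
qed simp

lemma act_degree_2:
  assumes "word_degree_x w = 2" "r < n"
    and A: "\<And>l r c. \<not> is_x l \<Longrightarrow> r < n \<Longrightarrow> c < n \<Longrightarrow>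
      B1 l r c = B l r c \<and> B2 l r c = B l r c \<and> D l r c = B l r c"
    and X: "\<And>l r c. is_x l \<Longrightarrow> r < n \<Longrightarrow> c < n \<Longrightarrow>
      B l r c = t * B1 l r c + (1 - t) * B2 l r c \<and> D l r c = B1 l r c - B2 l r c"
  shows "t * act n B1 w y r + (1 - t) * act n B2 w y r - act n B w y r = t * (1 - t) * act n D w y r"
  using assms(1,2)
proof (induction w arbitrary: r)
  case (Cons l w)
  show ?case
  proof (cases "is_x l")
    case True
    then have w: "word_degree_x w = 1" using Cons.prems by simp
    have "act n B w y c = t * act n B1 w y c + (1 - t) * act n B2 w y c" if "c < n" for c
      using A X by (intro act_degree_1 w that) auto
    moreover have "act n D w y c = 1 * act n B1 w y c + (- 1) * act n B2 w y c" if "c < n" for c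
      using A X by (intro act_degree_1 w that) auto
    ultimately show ?thesis
      using True X Cons.prems
      by (simp add: sum.distrib[symmetric] sum_subtractf[symmetric] sum_distrib_left)
        (intro sum.cong refl, simp add: algebra_simps)
  next
    case False
    have "t * act n B1 (l # w) y r + (1 - t) * act n B2 (l # w) y r - act n B (l # w) y r
      = (\<Sum>c<n. B l r c * (t * act n B1 w y c + (1 - t) * act n B2 w y c - act n B w y c))"
      using False A Cons.prems
      by (simp add: sum.distrib[symmetric] sum_subtractf[symmetric] sum_distrib_left)
        (intro sum.cong refl, simp add: algebra_simps)
    also have "\<dots> = (\<Sum>c<n. B l r c * (t * (1 - t) * act n D w y c))"
      using False Cons by (intro sum.cong refl) simp
    also have "\<dots> = t * (1 - t) * act n D (l # w) y r"
      using False A Cons.prems by (simp add: sum_distrib_left mult_ac)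
    finally show ?thesis .
  qed
qed simp

section \<open>Evaluation in matrices\<close>

lemma sum_mult_unit_vector:
  fixes f :: "nat \<Rightarrow> real"
  shows "k < n \<Longrightarrow> (\<Sum>c<n. f c * (if c = k then 1 else 0)) = f k"
    and "k < n \<Longrightarrow> (\<Sum>c<n. (if c = k then 1 else 0) * f c) = f k"
  by (simp_all add: if_distrib if_distribR cong: if_cong)

definition letter_entry :: "'g mat_tuple \<Rightarrow> 'g mat_tuple \<Rightarrow> 'g letter \<Rightarrow> nat \<Rightarrow> nat \<Rightarrow> real" where
  "letter_entry A X l r c = eval_letter A X l $$ (r, c)"

lemma sym_tuples_carrier: "X \<in> sym_tuples n \<Longrightarrow> X j \<in> carrier_mat n n"
  by (simp add: sym_tuples_def sym_mats_def)

lemma sym_tuples_dim [simp]: "X \<in> sym_tuples n \<Longrightarrow> dim_row (X j) = n" "X \<in> sym_tuples n \<Longrightarrow> dim_col (X j) = n"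
  using sym_tuples_carrier[of X n j] by auto

lemma sym_tuples_swap: "X \<in> sym_tuples n \<Longrightarrow> r < n \<Longrightarrow> c < n \<Longrightarrow> X j $$ (r, c) = X j $$ (c, r)"
  by (simp add: sym_tuples_def sym_mats_def) (metis carrier_matD index_transpose_mat(1))

lemma sym_tuplesI:
  assumes "\<And>j. X j \<in> carrier_mat n n" "\<And>j r c. r < n \<Longrightarrow> c < n \<Longrightarrow> X j $$ (r, c) = X j $$ (c, r)"
  shows "X \<in> sym_tuples n"
  using assms carrier_matD[OF assms(1)] by (auto simp: sym_tuples_def sym_mats_def intro!: eq_matI)

lemma letter_entry_swap:
  assumes "A \<in> sym_tuples n" "X \<in> sym_tuples n" "r < n" "c < n"
  shows "letter_entry A X l r c = letter_entry A X l c r"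
  using assms by (cases l) (auto simp: letter_entry_def sym_tuples_swap)

lemma letter_entry_simps:
  "is_x l \<Longrightarrow> letter_entry A X l r c = X (case l of VarA j \<Rightarrow> j | VarX j \<Rightarrow> j) $$ (r, c)"
  "\<not> is_x l \<Longrightarrow> letter_entry A X l r c = A (case l of VarA j \<Rightarrow> j | VarX j \<Rightarrow> j) $$ (r, c)"
  by (cases l; simp add: letter_entry_def)+

lemma lookup_rev_symmetric:
  assumes "symmetric_poly p"
  shows "Poly_Mapping.lookup p (rev w) = Poly_Mapping.lookup p w"
proof -
  have "Poly_Mapping.lookup p w = Poly_Mapping.lookup (Poly_Mapping.map_key rev p) w"
    using assms by (simp add: symmetric_poly_def involution_def)
  then show ?thesis by (simp add: map_key.rep_eq)
qed

context
  fixes n :: nat and A X :: "'g mat_tuple"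
  assumes AX: "A \<in> sym_tuples n" "X \<in> sym_tuples n"
begin

lemma eval_letter_carrier: "eval_letter A X l \<in> carrier_mat n n"
  using AX by (cases l) (simp_all add: sym_tuples_carrier)

lemma eval_word_carrier: "eval_word n A X w \<in> carrier_mat n n"
  using eval_letter_carrier by (induction w) (auto simp: eval_word_def intro!: mult_carrier_mat)

lemma eval_word_act:
  assumes "r < n"
  shows "(\<Sum>c<n. eval_word n A X w $$ (r, c) * y c) = act n (letter_entry A X) w y r"
  using assms
proof (induction w arbitrary: r)
  case Nil
  then have "(\<Sum>c<n. eval_word n A X [] $$ (r, c) * y c) = (\<Sum>c<n. if r = c then y c else 0)"
    by (intro sum.cong refl) (auto simp: eval_word_def)
  then show ?case using Nil by simp
next
  case (Cons l w)
  have entry: "eval_word n A X (l # w) $$ (r, c)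
      = (\<Sum>k<n. letter_entry A X l r k * eval_word n A X w $$ (k, c))" if "c < n" for c
    using Cons.prems that eval_letter_carrier[of l] eval_word_carrier[of w]
    by (auto simp: eval_word_def letter_entry_def scalar_prod_def atLeast0LessThan intro!: sum.cong)
  have "(\<Sum>c<n. eval_word n A X (l # w) $$ (r, c) * y c)
      = (\<Sum>c<n. \<Sum>k<n. letter_entry A X l r k * (eval_word n A X w $$ (k, c) * y c))"
    using entry by (intro sum.cong refl) (simp add: sum_distrib_right mult.assoc)
  also have "\<dots> = (\<Sum>k<n. letter_entry A X l r k * (\<Sum>c<n. eval_word n A X w $$ (k, c) * y c))"
    unfolding sum_distrib_left by (rule sum.swap)
  finally show ?case using Cons.IH by simp
qed

lemma eval_poly_act:
  assumes "r < n"
  shows "(\<Sum>c<n. eval_poly n p A X $$ (r, c) * y c)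
    = (\<Sum>w\<in>Poly_Mapping.keys p. Poly_Mapping.lookup p w * act n (letter_entry A X) w y r)"
proof -
  have "(\<Sum>c<n. eval_poly n p A X $$ (r, c) * y c)
      = (\<Sum>c<n. \<Sum>w\<in>Poly_Mapping.keys p. Poly_Mapping.lookup p w * (eval_word n A X w $$ (r, c) * y c))"
    using assms by (intro sum.cong refl) (simp add: eval_poly_def sum_distrib_right mult.assoc)
  also have "\<dots> = (\<Sum>w\<in>Poly_Mapping.keys p. Poly_Mapping.lookup p w * act n (letter_entry A X) w y r)"
    unfolding eval_word_act[OF assms, symmetric] sum_distrib_left by (rule sum.swap)
  finally show ?thesis .
qed

lemma eval_poly_swap:
  assumes "symmetric_poly p" "r < n" "c < n"
  shows "eval_poly n p A X $$ (r, c) = eval_poly n p A X $$ (c, r)"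
proof -
  define d where "d i = (\<lambda>k. if k = i then 1 else (0::real))" for i :: nat
  have word: "eval_word n A X w $$ (r', c') = act n (letter_entry A X) w (d c') r'"
    if "r' < n" "c' < n" for r' c' w
    using eval_word_act[OF that(1), of w "d c'"] that by (simp add: d_def sum_mult_unit_vector)
  have "act n (letter_entry A X) (rev w) (d r) c = act n (letter_entry A X) w (d c) r" for w
    using act_adjoint[of n "letter_entry A X" "d r" w "d c"] letter_entry_swap[OF AX] assms
    by (simp add: d_def sum_mult_unit_vector)
  then have word_swap: "eval_word n A X (rev w) $$ (c, r) = eval_word n A X w $$ (r, c)" for w
    using assms by (simp add: word)
  note lookup = lookup_rev_symmetric[OF assms(1)]
  have "bij_betw rev (Poly_Mapping.keys p) (Poly_Mapping.keys p)"
    by (rule bij_betw_byWitness[where f' = rev]) (auto simp: in_keys_iff lookup)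
  then show ?thesis
    using assms unfolding eval_poly_def
    by (simp add: sum.reindex_bij_betw[symmetric, of rev _ _ "\<lambda>w. Poly_Mapping.lookup p w * eval_word n A X w $$ (c, r)"]
        lookup word_swap)
qed

end

lemma psd_iff_quad_form:
  assumes "P \<in> carrier_mat n n"
  shows "psd P \<longleftrightarrow> (\<forall>r<n. \<forall>c<n. P $$ (r, c) = P $$ (c, r)) \<and>
    (\<forall>y. 0 \<le> quad_form {..<n} (\<lambda>r c. P $$ (r, c)) y)"
proof -
  have "transpose_mat P = P \<longleftrightarrow> (\<forall>r<n. \<forall>c<n. P $$ (r, c) = P $$ (c, r))"
    using assms by (auto simp: mat_eq_iff)
  moreover have "v \<bullet> (P *\<^sub>v v) = quad_form {..<n} (\<lambda>r c. P $$ (r, c)) (\<lambda>i. vec_index v i)" if "v \<in> carrier_vec n" for v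
    using assms that
    by (auto simp: quad_form_def scalar_prod_def atLeast0LessThan sum_distrib_left mult_ac intro!: sum.cong)
  moreover have "(\<forall>v\<in>carrier_vec n. 0 \<le> quad_form {..<n} (\<lambda>r c. P $$ (r, c)) (\<lambda>i. vec_index v i))
      \<longleftrightarrow> (\<forall>y. 0 \<le> quad_form {..<n} (\<lambda>r c. P $$ (r, c)) y)"
  proof (intro iffI allI ballI)
    fix y assume *: "\<forall>v\<in>carrier_vec n. 0 \<le> quad_form {..<n} (\<lambda>r c. P $$ (r, c)) (\<lambda>i. vec_index v i)"
    have "quad_form {..<n} (\<lambda>r c. P $$ (r, c)) (\<lambda>i. vec_index (vec n y) i) = quad_form {..<n} (\<lambda>r c. P $$ (r, c)) y"
      by (intro quad_form_cong) simp_all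
    then show "0 \<le> quad_form {..<n} (\<lambda>r c. P $$ (r, c)) y" using * by (metis vec_carrier)
  qed simp
  ultimately show ?thesis using assms by (simp add: psd_def)
qed

definition convexity_defect ::
  "nat \<Rightarrow> 'g ncpoly \<Rightarrow> real \<Rightarrow> 'g mat_tuple \<Rightarrow> 'g mat_tuple \<Rightarrow> 'g mat_tuple \<Rightarrow> real mat" where
  "convexity_defect n p t A X Y =
    t \<cdot>\<^sub>m eval_poly n p A X + (1 - t) \<cdot>\<^sub>m eval_poly n p A Y - eval_poly n p A (tuple_comb t X Y)"

definition word_defect ::
  "nat \<Rightarrow> real \<Rightarrow> 'g mat_tuple \<Rightarrow> 'g mat_tuple \<Rightarrow> 'g mat_tuple \<Rightarrow> 'g letter list \<Rightarrow> (nat \<Rightarrow> real) \<Rightarrow> nat \<Rightarrow> real" where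
  "word_defect n t A X Y w y r = t * act n (letter_entry A X) w y r
    + (1 - t) * act n (letter_entry A Y) w y r - act n (letter_entry A (tuple_comb t X Y)) w y r"

lemma convexity_defect_carrier: "convexity_defect n p t A X Y \<in> carrier_mat n n"
  by (intro carrier_matI) (simp_all add: convexity_defect_def eval_poly_def)

lemma tuple_comb_sym:
  assumes "X \<in> sym_tuples n" "Y \<in> sym_tuples n"
  shows "tuple_comb t X Y \<in> sym_tuples n"
proof (rule sym_tuplesI)
  show "tuple_comb t X Y j \<in> carrier_mat n n" for j
    using assms by (simp add: tuple_comb_def sym_tuples_carrier)
  show "tuple_comb t X Y j $$ (r, c) = tuple_comb t X Y j $$ (c, r)" if "r < n" "c < n" for j r c
    using that assms sym_tuples_swap[of X n r c j] sym_tuples_swap[of Y n r c j]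
    by (simp add: tuple_comb_def)
qed

lemma tuple_comb_entry:
  assumes "X \<in> sym_tuples n" "Y \<in> sym_tuples n" "r < n" "c < n"
  shows "tuple_comb t X Y j $$ (r, c) = t * X j $$ (r, c) + (1 - t) * Y j $$ (r, c)"
  using assms by (simp add: tuple_comb_def)

context
  fixes n :: nat and A X Y :: "'g mat_tuple"
  assumes AXY: "A \<in> sym_tuples n" "X \<in> sym_tuples n" "Y \<in> sym_tuples n"
begin

lemma convexity_defect_act:
  assumes "r < n"
  shows "(\<Sum>c<n. convexity_defect n p t A X Y $$ (r, c) * y c)
    = (\<Sum>w\<in>Poly_Mapping.keys p. Poly_Mapping.lookup p w * word_defect n t A X Y w y r)"
proof -
  have "(\<Sum>c<n. convexity_defect n p t A X Y $$ (r, c) * y c)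
      = t * (\<Sum>c<n. eval_poly n p A X $$ (r, c) * y c)
      + (1 - t) * (\<Sum>c<n. eval_poly n p A Y $$ (r, c) * y c)
      - (\<Sum>c<n. eval_poly n p A (tuple_comb t X Y) $$ (r, c) * y c)"
    unfolding sum_distrib_left sum.distrib[symmetric] sum_subtractf[symmetric]
    using assms by (intro sum.cong refl) (simp add: convexity_defect_def eval_poly_def algebra_simps)
  also have "\<dots> = (\<Sum>w\<in>Poly_Mapping.keys p. Poly_Mapping.lookup p w * word_defect n t A X Y w y r)"
    unfolding eval_poly_act[OF AXY(1,2) assms] eval_poly_act[OF AXY(1,3) assms]
      eval_poly_act[OF AXY(1) tuple_comb_sym[OF AXY(2,3)] assms]
      sum_distrib_left sum.distrib[symmetric] sum_subtractf[symmetric]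
    by (intro sum.cong refl) (simp add: word_defect_def algebra_simps)
  finally show ?thesis .
qed

lemma convexity_defect_entry:
  assumes "r < n" "c < n"
  shows "convexity_defect n p t A X Y $$ (r, c) = (\<Sum>w\<in>Poly_Mapping.keys p.
    Poly_Mapping.lookup p w * word_defect n t A X Y w (\<lambda>k. if k = c then 1 else 0) r)"
  using convexity_defect_act[OF assms(1), of p t "\<lambda>k. if k = c then 1 else 0"] assms(2) by (simp only: sum_mult_unit_vector)

lemma convexity_defect_quad_form:
  "quad_form {..<n} (\<lambda>r c. convexity_defect n p t A X Y $$ (r, c)) y
    = (\<Sum>w\<in>Poly_Mapping.keys p. Poly_Mapping.lookup p w * (\<Sum>r<n. y r * word_defect n t A X Y w y r))"
proof -
  have "quad_form {..<n} (\<lambda>r c. convexity_defect n p t A X Y $$ (r, c)) y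
      = (\<Sum>r<n. y r * (\<Sum>c<n. convexity_defect n p t A X Y $$ (r, c) * y c))"
    unfolding quad_form_def sum_distrib_left by (intro sum.cong refl) (simp add: mult_ac)
  also have "\<dots> = (\<Sum>r<n. \<Sum>w\<in>Poly_Mapping.keys p.
      Poly_Mapping.lookup p w * (y r * word_defect n t A X Y w y r))"
    by (intro sum.cong refl) (simp add: convexity_defect_act, simp add: sum_distrib_left mult_ac)
  also have "\<dots> = (\<Sum>w\<in>Poly_Mapping.keys p. Poly_Mapping.lookup p w * (\<Sum>r<n. y r * word_defect n t A X Y w y r))"
    unfolding sum_distrib_left by (rule sum.swap)
  finally show ?thesis .
qed

lemma loewner_ge_comb_iff:
  assumes "symmetric_poly p"
  shows "t \<cdot>\<^sub>m eval_poly n p A X + (1 - t) \<cdot>\<^sub>m eval_poly n p A Y \<succeq> eval_poly n p A (tuple_comb t X Y)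
    \<longleftrightarrow> (\<forall>y. 0 \<le> quad_form {..<n} (\<lambda>r c. convexity_defect n p t A X Y $$ (r, c)) y)"
proof -
  have "convexity_defect n p t A X Y $$ (r, c) = convexity_defect n p t A X Y $$ (c, r)" if "r < n" "c < n" for r c
    using eval_poly_swap[OF AXY(1,2) assms that] eval_poly_swap[OF AXY(1,3) assms that]
      eval_poly_swap[OF AXY(1) tuple_comb_sym[OF AXY(2,3)] assms that] that
    unfolding convexity_defect_def by (simp add: eval_poly_def)
  then show ?thesis
    using psd_iff_quad_form[OF convexity_defect_carrier]
    unfolding loewner_ge_def convexity_defect_def[symmetric] by blast
qed

text \<open>In degree at most two the defect depends only on the direction \<open>X - Y\<close> of the segment and not on
  its position.\<close>

lemma word_defect_degree_le_2:
  assumes "word_degree_x w \<le> 2" "r < n"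
  shows "word_defect n t A X Y w y r = (if word_degree_x w = 2
    then t * (1 - t) * act n (letter_entry A (\<lambda>j. X j - Y j)) w y r else 0)"
proof -
  define B where "B = letter_entry A (tuple_comb t X Y)"
  have A: "letter_entry A X l i c = B l i c \<and> letter_entry A Y l i c = B l i c
      \<and> letter_entry A (\<lambda>j. X j - Y j) l i c = B l i c" if "\<not> is_x l" for l i c
    using that by (simp add: letter_entry_simps B_def)
  have X: "B l i c = t * letter_entry A X l i c + (1 - t) * letter_entry A Y l i c
      \<and> letter_entry A (\<lambda>j. X j - Y j) l i c = letter_entry A X l i c - letter_entry A Y l i c"
    if "is_x l" "i < n" "c < n" for l i c
    using that AXY by (simp add: letter_entry_simps B_def tuple_comb_entry)
  consider "word_degree_x w = 0" | "word_degree_x w = 1" | "word_degree_x w = 2"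
    using assms(1) by linarith
  then show ?thesis
  proof cases
    case 1
    have "act n (letter_entry A X) w y r = act n B w y r" "act n (letter_entry A Y) w y r = act n B w y r"
      using A by (intro act_degree_0 1 assms(2); simp)+
    then show ?thesis using 1 by (simp add: word_defect_def B_def algebra_simps)
  next
    case 2
    have "act n B w y r = t * act n (letter_entry A X) w y r + (1 - t) * act n (letter_entry A Y) w y r"
      using A X by (intro act_degree_1 2 assms(2)) auto
    then show ?thesis using 2 by (simp add: word_defect_def B_def)
  next
    case 3
    have "t * act n (letter_entry A X) w y r + (1 - t) * act n (letter_entry A Y) w y r - act n B w y r
        = t * (1 - t) * act n (letter_entry A (\<lambda>j. X j - Y j)) w y r"
      using A X by (intro act_degree_2 3 assms(2)) auto
    then show ?thesis using 3 by (simp add: word_defect_def B_def)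
  qed
qed

end

section \<open>Points of the domain and their neighbourhoods\<close>

text \<open>The direct sum of \<open>m\<close> copies of \<open>X\<close>: the index \<open>r\<close> belongs to the copy \<open>r div k\<close> and has the
  position \<open>r mod k\<close> in it.\<close>

definition copies :: "nat \<Rightarrow> 'g mat_tuple \<Rightarrow> nat \<Rightarrow> 'g mat_tuple" where
  "copies k X m j = mat (m * k) (m * k) (\<lambda>(r, c).
     if r div k = c div k then X j $$ (r mod k, c mod k) else 0)"

lemma copies_Suc:
  assumes "k > 0" "X \<in> sym_tuples k"
  shows "direct_sum (m * k) k (copies k X m) X = copies k X (Suc m)"
proof (rule ext, rule eq_matI)
  fix j r c
  assume rc: "r < dim_row (copies k X (Suc m) j)" "c < dim_col (copies k X (Suc m) j)"
  have split: "i div k < m \<or> (i div k = m \<and> i mod k = i - m * k \<and> m * k \<le> i)" "i < m * k \<longleftrightarrow> i div k < m"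
    if "i < Suc m * k" for i
  proof -
    show lt: "i < m * k \<longleftrightarrow> i div k < m" using assms by (simp add: div_less_iff_less_mult)
    have "i div k < Suc m" using that assms by (simp add: less_mult_imp_div_less)
    then show "i div k < m \<or> (i div k = m \<and> i mod k = i - m * k \<and> m * k \<le> i)"
      using lt by (auto simp: less_Suc_eq minus_mult_div_eq_mod[symmetric] mult.commute)
  qed
  have "r < Suc m * k" "c < Suc m * k" using rc by (simp_all add: copies_def)
  note r = split[OF this(1)] and c = split[OF this(2)]
  show "direct_sum (m * k) k (copies k X m) X j $$ (r, c) = copies k X (Suc m) j $$ (r, c)"
  proof -
    have dims: "r < m * k + k" "c < m * k + k" using rc by (simp_all add: copies_def)
    have "direct_sum (m * k) k (copies k X m) X j $$ (r, c) =
        (if r < m * k then if c < m * k then copies k X m j $$ (r, c) else 0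
         else if c < m * k then 0 else X j $$ (r - m * k, c - m * k))"
      using dims assms by (simp add: direct_sum_def copies_def)
    also have "\<dots> = copies k X (Suc m) j $$ (r, c)"
    proof (cases "r < m * k")
      case r_lt: True
      then have rm: "r div k < m" using r(2) by blast
      show ?thesis
      proof (cases "c < m * k")
        case True
        then show ?thesis using r_lt dims by (simp add: copies_def)
      next
        case False
        then have "c div k = m" using c by blast
        then show ?thesis using False r_lt rm dims by (simp add: copies_def)
      qed
    next
      case r_ge: False
      then have rm: "r div k = m" "r mod k = r - m * k" using r by blast+
      show ?thesis
      proof (cases "c < m * k")
        case True
        then have "c div k < m" using c(2) by blast
        then show ?thesis using True r_ge rm dims by (simp add: copies_def)
      next
        case False
        then have "c div k = m" "c mod k = c - m * k" using c by blast+
        then show ?thesis using False r_ge rm dims by (simp add: copies_def)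
      qed
    qed
    finally show ?thesis .
  qed
qed (use assms in \<open>auto simp: direct_sum_def copies_def\<close>)

lemma copies_in_domain:
  assumes "nc_domain U" "k > 0" "X \<in> U k" "m > 0"
  shows "copies k X m \<in> U (m * k)"
  using assms(4)
proof (induction m rule: nat_induct_non_zero)
  case 1
  have "X \<in> sym_tuples k" using assms by (auto simp: nc_domain_def)
  then have "copies k X 1 = X" by (intro ext eq_matI) (auto simp: copies_def)
  then show ?case using assms by simp
next
  case (Suc m)
  have "X \<in> sym_tuples k" using assms by (auto simp: nc_domain_def)
  then have "copies k X (Suc m) = direct_sum (m * k) k (copies k X m) X"
    using copies_Suc assms(2) by metis
  moreover have "direct_sum (m * k) k (copies k X m) X \<in> U (m * k + k)"
    using assms Suc by (auto simp: nc_domain_def)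
  ultimately show ?case by (simp add: add.commute)
qed

text \<open>The ball of radius \<open>\<epsilon>\<close> is convex, so it contains the whole segment, as the notion of convexity
  requires.\<close>

lemma midpoint_convex_near:
  fixes U :: "nat \<Rightarrow> ('g::finite) mat_tuple set"
  assumes "nc_domain U" "open_domain U" "convex_in_x p (level_product sym_tuples U)"
    and "n > 0" "Z \<in> U n"
  obtains \<epsilon> where "\<epsilon> > 0"
    "\<And>A X Y. A \<in> sym_tuples n \<Longrightarrow> X \<in> sym_tuples n \<Longrightarrow> Y \<in> sym_tuples n \<Longrightarrow>
      (\<And>j r c. r < n \<Longrightarrow> c < n \<Longrightarrow> \<bar>X j $$ (r, c) - Z j $$ (r, c)\<bar> < \<epsilon>) \<Longrightarrow>
      (\<And>j r c. r < n \<Longrightarrow> c < n \<Longrightarrow> \<bar>Y j $$ (r, c) - Z j $$ (r, c)\<bar> < \<epsilon>) \<Longrightarrow>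
      psd (convexity_defect n p (1/2) A X Y)"
proof -
  obtain \<epsilon> where \<epsilon>: "\<epsilon> > 0" "\<forall>Y\<in>sym_tuples n.
      (\<forall>j. \<forall>r<n. \<forall>c<n. \<bar>Y j $$ (r, c) - Z j $$ (r, c)\<bar> < \<epsilon>) \<longrightarrow> Y \<in> U n"
    using assms(2,4,5) unfolding open_domain_def by blast
  have "psd (convexity_defect n p (1/2) A X Y)"
    if A: "A \<in> sym_tuples n" and X: "X \<in> sym_tuples n" and Y: "Y \<in> sym_tuples n"
      and near: "\<And>j r c. r < n \<Longrightarrow> c < n \<Longrightarrow> \<bar>X j $$ (r, c) - Z j $$ (r, c)\<bar> < \<epsilon>"
        "\<And>j r c. r < n \<Longrightarrow> c < n \<Longrightarrow> \<bar>Y j $$ (r, c) - Z j $$ (r, c)\<bar> < \<epsilon>" for A X Y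
  proof -
    have AA: "tuple_comb t A A = A" for t
      using A by (intro ext eq_matI) (auto simp: tuple_comb_def algebra_simps)
    have "tuple_comb t X Y \<in> U n" if "t \<in> {0..1}" for t
    proof -
      have "\<bar>tuple_comb t X Y j $$ (r, c) - Z j $$ (r, c)\<bar> < \<epsilon>" if rc: "r < n" "c < n" for j r c
      proof -
        define x y where "x = X j $$ (r, c) - Z j $$ (r, c)" "y = Y j $$ (r, c) - Z j $$ (r, c)"
        have xy: "\<bar>x\<bar> < \<epsilon>" "\<bar>y\<bar> < \<epsilon>" using near rc by (simp_all add: x_y_def)
        have "tuple_comb t X Y j $$ (r, c) - Z j $$ (r, c) = t * x + (1 - t) * y"
          using X Y rc by (simp add: x_y_def tuple_comb_entry algebra_simps)
        also have "\<bar>t * x + (1 - t) * y\<bar> \<le> t * \<bar>x\<bar> + (1 - t) * \<bar>y\<bar>"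
          using \<open>t \<in> {0..1}\<close> by (intro order_trans[OF abs_triangle_ineq]) (simp add: abs_mult)
        also have "\<dots> < \<epsilon>"
          using \<open>t \<in> {0..1}\<close> xy by (intro convex_bound_lt) auto
        finally show ?thesis .
      qed
      then show ?thesis using \<epsilon>(2) tuple_comb_sym[OF X Y] by blast
    qed
    moreover have "X \<in> U n" "Y \<in> U n" using \<epsilon>(2) X Y near by blast+
    ultimately have "\<forall>t\<in>{0..1}. t \<cdot>\<^sub>m eval_poly n p A X + (1 - t) \<cdot>\<^sub>m eval_poly n p A Y
        \<succeq> eval_poly n p A (tuple_comb t X Y)"
      using assms(3,4) A unfolding convex_in_x_def level_product_def by (simp add: AA)
    moreover have "1 / 2 \<in> {0..1::real}" by simp
    ultimately show ?thesis unfolding loewner_ge_def convexity_defect_def by blast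
  qed
  then show ?thesis using that \<epsilon>(1) by blast
qed

text \<open>The defect of convexity at the midpoint \<open>Z\<close> of \<open>Z + s H\<close> and \<open>Z - s H\<close> is \<open>s\<^sup>2\<close> times the part of
  degree two at \<open>(A, H)\<close>. So the smallness of the neighbourhood is no restriction on \<open>H\<close>.\<close>

lemma degree_two_part_nonneg:
  fixes U :: "nat \<Rightarrow> ('g::finite) mat_tuple set"
  assumes U: "nc_domain U" "open_domain U" "convex_in_x p (level_product sym_tuples U)"
    and n: "n > 0" "Z \<in> U n"
    and deg: "\<And>w. w \<in> Poly_Mapping.keys p \<Longrightarrow> word_degree_x w \<le> 2"
    and AH: "A \<in> sym_tuples n" "H \<in> sym_tuples n"
  shows "0 \<le> (\<Sum>w\<in>{w \<in> Poly_Mapping.keys p. word_degree_x w = 2}.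
    Poly_Mapping.lookup p w * (\<Sum>r<n. y r * act n (letter_entry A H) w y r))"
proof -
  obtain \<epsilon> where \<epsilon>: "\<epsilon> > 0"
    "\<And>A X Y. A \<in> sym_tuples n \<Longrightarrow> X \<in> sym_tuples n \<Longrightarrow> Y \<in> sym_tuples n \<Longrightarrow>
      (\<And>j r c. r < n \<Longrightarrow> c < n \<Longrightarrow> \<bar>X j $$ (r, c) - Z j $$ (r, c)\<bar> < \<epsilon>) \<Longrightarrow>
      (\<And>j r c. r < n \<Longrightarrow> c < n \<Longrightarrow> \<bar>Y j $$ (r, c) - Z j $$ (r, c)\<bar> < \<epsilon>) \<Longrightarrow>
      psd (convexity_defect n p (1/2) A X Y)"
    using midpoint_convex_near[OF U n] by blast
  have Z: "Z \<in> sym_tuples n" using U(1) n by (auto simp: nc_domain_def)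
  define C where "C = (\<Sum>j\<in>UNIV. \<Sum>r<n. \<Sum>c<n. \<bar>H j $$ (r, c)\<bar>)"
  have C: "\<bar>H j $$ (r, c)\<bar> \<le> C" if "r < n" "c < n" for j r c
  proof -
    have "\<bar>H j $$ (r, c)\<bar> \<le> (\<Sum>c<n. \<bar>H j $$ (r, c)\<bar>)"
      using that by (intro member_le_sum) auto
    also have "\<dots> \<le> (\<Sum>r<n. \<Sum>c<n. \<bar>H j $$ (r, c)\<bar>)"
      using that by (intro member_le_sum[of r _ "\<lambda>r. \<Sum>c<n. \<bar>H j $$ (r, c)\<bar>"]) (auto intro: sum_nonneg)
    also have "\<dots> \<le> C"
      unfolding C_def by (intro member_le_sum[of j _ "\<lambda>j. \<Sum>r<n. \<Sum>c<n. \<bar>H j $$ (r, c)\<bar>"]) (auto intro: sum_nonneg)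
    finally show ?thesis .
  qed
  have C0: "0 \<le> C" unfolding C_def by (intro sum_nonneg) auto
  define s where "s = \<epsilon> / (C + 1)"
  have s: "s > 0" and sC: "s * C < \<epsilon>"
    using \<epsilon>(1) C0 by (simp_all add: s_def field_simps)
  define X where "X a j = Z j + a \<cdot>\<^sub>m H j" for a j
  have X_entry: "X a j $$ (r, c) = Z j $$ (r, c) + a * H j $$ (r, c)" if "r < n" "c < n" for a j r c
    using that AH by (simp add: X_def)
  have X_sym: "X a \<in> sym_tuples n" for a
    using AH Z sym_tuples_swap[OF Z] sym_tuples_swap[OF AH(2)]
    by (intro sym_tuplesI) (auto simp: X_entry X_def sym_tuples_carrier)
  have near: "\<bar>X a j $$ (r, c) - Z j $$ (r, c)\<bar> < \<epsilon>" if "\<bar>a\<bar> = s" "r < n" "c < n" for a j r c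
  proof -
    have "\<bar>X a j $$ (r, c) - Z j $$ (r, c)\<bar> \<le> s * C"
      using that C[OF that(2,3)] s by (simp add: X_entry abs_mult mult_left_mono)
    then show ?thesis using sC by simp
  qed
  have "psd (convexity_defect n p (1/2) A (X s) (X (- s)))"
    using near s by (intro \<epsilon>(2) AH X_sym) auto
  then have "0 \<le> quad_form {..<n} (\<lambda>r c. convexity_defect n p (1/2) A (X s) (X (- s)) $$ (r, c)) y"
    using psd_iff_quad_form[OF convexity_defect_carrier] by blast
  also have "\<dots> = (\<Sum>w\<in>Poly_Mapping.keys p. Poly_Mapping.lookup p w *
      (\<Sum>r<n. y r * word_defect n (1/2) A (X s) (X (- s)) w y r))"
    by (rule convexity_defect_quad_form[OF AH(1) X_sym X_sym])
  also have "\<dots> = (\<Sum>w\<in>Poly_Mapping.keys p. if word_degree_x w = 2 then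
      s\<^sup>2 * (Poly_Mapping.lookup p w * (\<Sum>r<n. y r * act n (letter_entry A H) w y r)) else 0)"
  proof (intro sum.cong refl)
    fix w assume w: "w \<in> Poly_Mapping.keys p"
    have "word_defect n (1/2) A (X s) (X (- s)) w y r
        = (if word_degree_x w = 2 then s\<^sup>2 * act n (letter_entry A H) w y r else 0)" if "r < n" for r
    proof -
      have "act n (letter_entry A (\<lambda>j. X s j - X (- s) j)) w y r
          = (2 * s) ^ word_degree_x w * act n (letter_entry A H) w y r"
        using AH Z that
        by (intro act_scale) (auto simp: letter_entry_simps X_entry, auto simp: X_def)
      then show ?thesis
        using word_defect_degree_le_2[OF AH(1) X_sym X_sym deg[OF w] that, of "1/2" s "- s" y]
        by (auto simp: power2_eq_square)
    qed
    then show "Poly_Mapping.lookup p w * (\<Sum>r<n. y r * word_defect n (1/2) A (X s) (X (- s)) w y r)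
      = (if word_degree_x w = 2 then
        s\<^sup>2 * (Poly_Mapping.lookup p w * (\<Sum>r<n. y r * act n (letter_entry A H) w y r)) else 0)"
      by (simp add: sum_distrib_left mult_ac)
  qed
  also have "\<dots> = s\<^sup>2 * (\<Sum>w\<in>{w \<in> Poly_Mapping.keys p. word_degree_x w = 2}.
      Poly_Mapping.lookup p w * (\<Sum>r<n. y r * act n (letter_entry A H) w y r))"
    by (simp add: sum.inter_filter sum_distrib_left if_distrib cong: if_cong)
  finally show ?thesis using s by (simp add: zero_le_mult_iff)
qed

section \<open>The degree bound\<close>

text \<open>The edge between the positions \<open>i\<close> and \<open>i + 1\<close> of the path carries the letter \<open>ws ! i\<close> and the
  weight \<open>wt i\<close>.\<close>

definition edge :: "'l list \<Rightarrow> (nat \<Rightarrow> real) \<Rightarrow> 'l \<Rightarrow> nat \<Rightarrow> nat \<Rightarrow> real" where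
  "edge ws wt l a b =
    (if b = Suc a \<and> a < length ws \<and> ws ! a = l then wt a
     else if a = Suc b \<and> b < length ws \<and> ws ! b = l then wt b else 0)"

lemma edge_swap: "edge ws wt l a b = edge ws wt l b a"
  by (auto simp: edge_def)

lemma edge_nonzeroD:
  "edge ws wt l a b \<noteq> 0 \<Longrightarrow> (a < length ws \<and> ws ! a = l \<and> b = Suc a) \<or> (b < length ws \<and> ws ! b = l \<and> a = Suc b)"
  by (auto simp: edge_def split: if_splits)

text \<open>The matrices act on the tensor product of the space of the path, with the positions \<open>0\<close> to
  \<open>length ws\<close>, and \<open>\<real>\<^sup>k\<close>: the index \<open>r\<close> has the position \<open>r div k\<close> on the path.\<close>

locale path_walk =
  fixes ws :: "'g letter list" and k :: nat
  assumes k: "k > 0"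
begin

abbreviation "L \<equiv> length ws"

abbreviation "n \<equiv> Suc L * k"

definition dg :: "nat \<Rightarrow> nat" where
  "dg i = word_degree_x (drop i ws)"

text \<open>The first unit vector of \<open>\<real>\<^sup>k\<close> at the right end of the path. Since words act from the left, walks
  start there.\<close>

definition target :: "nat \<Rightarrow> real" where
  "target r = (if r = L * k then 1 else 0)"

text \<open>Every letter acts along its edges and trivially on \<open>\<real>\<^sup>k\<close>. In addition, a letter of degree one
  may act arbitrarily on \<open>\<real>\<^sup>k\<close> without moving on the path; this leaves room for the copies of the
  base point.\<close>

definition walk_kernel :: "('g letter \<Rightarrow> nat \<Rightarrow> nat \<Rightarrow> real) \<Rightarrow> (nat \<Rightarrow> real) \<Rightarrow> bool" where
  "walk_kernel B wt \<longleftrightarrow> (\<forall>l. \<forall>r<n. \<forall>c<n.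
     (r div k \<noteq> c div k \<or> \<not> is_x l \<longrightarrow>
       B l r c = (if r mod k = c mod k then edge ws wt l (r div k) (c div k) else 0)))"

lemma dg_Suc: "i < L \<Longrightarrow> dg i = (if is_x (ws ! i) then Suc (dg (Suc i)) else dg (Suc i))"
  by (simp add: dg_def Cons_nth_drop_Suc[symmetric])

lemma dg_length [simp]: "dg L = 0"
  by (simp add: dg_def)

lemma walk_step:
  assumes "walk_kernel B wt" "r < n" "c < n" "B l r c \<noteq> 0"
  obtains (stay) "is_x l" "c div k = r div k"
  | (right) "c div k = Suc (r div k)" "ws ! (r div k) = l" "drop (r div k) ws = l # drop (c div k) ws"
      "dg (r div k) = (if is_x l then Suc (dg (c div k)) else dg (c div k))"
  | (left) "r div k = Suc (c div k)" "c div k < L"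
      "dg (c div k) = (if is_x l then Suc (dg (r div k)) else dg (r div k))"
proof (cases "r div k \<noteq> c div k \<or> \<not> is_x l")
  case True
  then have "B l r c = (if r mod k = c mod k then edge ws wt l (r div k) (c div k) else 0)"
    using assms(1-3) unfolding walk_kernel_def by blast
  then have "edge ws wt l (r div k) (c div k) \<noteq> 0"
    using assms(4) by (auto split: if_splits)
  from edge_nonzeroD[OF this] consider "r div k < L" "ws ! (r div k) = l" "c div k = Suc (r div k)"
    | "c div k < L" "ws ! (c div k) = l" "r div k = Suc (c div k)"
    by blast
  then show ?thesis
  proof cases
    case 1
    then show ?thesis using right dg_Suc[OF 1(1)] Cons_nth_drop_Suc[OF 1(1)] by simp
  next
    case 2
    then show ?thesis using left dg_Suc[OF 2(1)] by simp
  qed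
next
  case False
  then show ?thesis using stay by simp
qed

text \<open>A walk from the right end to some position crosses all edges in between, so it costs at least
  their degree. If it costs no more, it has not paused and has crossed every \<open>x\<close>-edge in between
  only once, so that its length is at least the distance, with equality only for the direct walk.\<close>

lemma walk_reaches:
  assumes B: "walk_kernel B wt"
    and "r < n" "act n B u target r \<noteq> 0"
  shows "dg (r div k) \<le> word_degree_x u \<and> (word_degree_x u = dg (r div k) \<longrightarrow>
    L - r div k \<le> length u \<and> (length u = L - r div k \<longrightarrow> u = drop (r div k) ws))"
  using assms(2,3)
proof (induction u arbitrary: r)
  case Nil
  then have "r div k = L" using k by (auto simp: target_def split: if_splits)
  then show ?case by simp
next
  case (Cons l u)
  then obtain c where c: "c < n" "B l r c \<noteq> 0" "act n B u target c \<noteq> 0"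
    by (auto elim!: sum.not_neutral_contains_not_neutral)
  note IH = Cons.IH[OF c(1,3)]
  have pos: "r div k \<le> L" "c div k \<le> L"
    using Cons.prems(1) c(1) k by (simp_all add: less_Suc_eq_le[symmetric] less_mult_imp_div_less del: mult_Suc)
  from B Cons.prems(1) c(1,2) show ?case
  proof (cases rule: walk_step)
    case stay
    then show ?thesis using IH by simp
  next
    case right
    then show ?thesis using IH pos by (cases "is_x l") auto
  next
    case left
    then show ?thesis using IH pos by (cases "is_x l") auto
  qed
qed

text \<open>A word that spells out the rest of the path has no choice but to follow it: pausing costs
  a letter of degree one, and a step back costs either degree or length.\<close>

lemma walk_along_path:
  assumes B: "walk_kernel B wt" and "i \<le> L"
  shows "act n B (drop i ws) target (i * k) = (\<Prod>m\<in>{i..<L}. wt m)"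
  using assms(2)
proof (induction i rule: inc_induct)
  case base
  show ?case by (simp add: target_def)
next
  case (step i)
  define c0 where "c0 = Suc i * k"
  have bounds: "i * k < n" "c0 < n" unfolding c0_def using step.hyps k by (auto intro!: mult_less_mono1 simp del: mult_Suc)
  have div: "i * k div k = i" "c0 div k = Suc i" "i * k mod k = 0" "c0 mod k = 0"
    using k by (simp_all add: c0_def)
  have other: "B (ws ! i) (i * k) c * act n B (drop (Suc i) ws) target c = 0" if c: "c < n" "c \<noteq> c0" for c
  proof (rule ccontr)
    assume "\<not> ?thesis"
    then have nz: "B (ws ! i) (i * k) c \<noteq> 0" "act n B (drop (Suc i) ws) target c \<noteq> 0" by auto
    note reach = walk_reaches[OF B c(1) nz(2)]
    have pos: "c div k \<le> L"
      using c(1) k by (simp add: less_Suc_eq_le[symmetric] less_mult_imp_div_less del: mult_Suc)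
    from B bounds(1) c(1) nz(1) show False
    proof (cases rule: walk_step)
      case stay
      then show False using reach dg_Suc[OF step.hyps(2)] by (simp add: div) (simp add: dg_def)
    next
      case right
      have "c mod k \<noteq> 0"
        using c(2) right div by (metis c0_def div_mult_mod_eq add.right_neutral)
      then have "B (ws ! i) (i * k) c = 0"
        using B bounds c(1) right div unfolding walk_kernel_def by simp
      then show False using nz by simp
    next
      case left
      then have i: "i = Suc (c div k)" and "dg i \<le> dg (c div k)"
        unfolding div(1) by (auto split: if_splits)
      then have "dg (Suc i) \<le> dg (c div k)"
        using dg_Suc[OF step.hyps(2)] by (auto split: if_splits)
      then have "word_degree_x (drop (Suc i) ws) = dg (c div k)" using reach by (simp add: dg_def)
      then have "L - c div k \<le> L - Suc i" using reach by simp
      then show False using i step.hyps(2) by linarith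
    qed
  qed
  have "act n B (drop i ws) target (i * k)
      = (\<Sum>c<n. B (ws ! i) (i * k) c * act n B (drop (Suc i) ws) target c)"
    using step.hyps by (simp add: Cons_nth_drop_Suc[symmetric])
  also have "\<dots> = B (ws ! i) (i * k) c0 * act n B (drop (Suc i) ws) target c0"
  proof -
    have "(\<Sum>c\<in>{..<n} - {c0}. B (ws ! i) (i * k) c * act n B (drop (Suc i) ws) target c) = 0"
      by (intro sum.neutral ballI other) auto
    then show ?thesis using bounds by (subst sum.remove[of _ c0]) simp_all
  qed
  also have "B (ws ! i) (i * k) c0 = wt i"
    using B bounds div step.hyps unfolding walk_kernel_def by (simp add: edge_def)
  also have "act n B (drop (Suc i) ws) target c0 = (\<Prod>m\<in>{Suc i..<L}. wt m)"
    using step.IH by (simp add: c0_def)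
  also have "wt i * \<dots> = (\<Prod>m\<in>{i..<L}. wt m)"
    using step.hyps by (simp add: prod.atLeast_Suc_lessThan)
  finally show ?case .
qed

text \<open>For the whole path, the bounds on degree and length in the hypotheses leave no slack, so the
  direct walk is the only one.\<close>

lemma walk_through:
  assumes "walk_kernel B wt"
    and "word_degree_x w \<le> word_degree_x ws"
    and "word_degree_x w = word_degree_x ws \<Longrightarrow> length w \<le> L"
  shows "act n B w target 0 = (if w = ws then \<Prod>m<L. wt m else 0)"
proof (cases "w = ws")
  case True
  then show ?thesis using walk_along_path[OF assms(1), of 0] by (simp add: atLeast0LessThan)
next
  case False
  have "dg 0 = word_degree_x ws" by (simp add: dg_def)
  then show ?thesis
    using walk_reaches[OF assms(1), of 0 w] assms(2,3) False k by (cases "act n B w target 0 = 0") auto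
qed

text \<open>The entry at \<open>r\<close> depends on the part of the path up to the edge \<open>i\<close> only through walks that cross
  this edge and come back to \<open>r\<close>. They cross every edge from \<open>i\<close> to the position of \<open>r\<close> twice and all
  later ones once, which needs the degree \<open>2 * dg i - dg (r div k)\<close>.\<close>

lemma walk_back_local:
  assumes B: "walk_kernel B wt" "walk_kernel B' wt'"
    and same: "\<And>l r c. r < n \<Longrightarrow> c < n \<Longrightarrow> i < r div k \<Longrightarrow> i < c div k \<Longrightarrow> B l r c = B' l r c"
    and "r < n" "i < r div k" "word_degree_x u + dg (r div k) < 2 * dg i"
  shows "act n B u target r = act n B' u target r"
  using assms(4-)
proof (induction u arbitrary: r)
  case (Cons l u)
  have pos: "c div k \<le> L" if "c < n" for c
    using that k by (simp add: less_Suc_eq_le[symmetric] less_mult_imp_div_less del: mult_Suc)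
  have cut: "C l r c * act n C u target c = 0"
    if "walk_kernel C v" "c < n" "c div k \<le> i" for C v c
  proof (rule ccontr)
    assume "\<not> ?thesis"
    then have nz: "C l r c \<noteq> 0" "act n C u target c \<noteq> 0" by auto
    have reach: "dg (c div k) \<le> word_degree_x u" using walk_reaches[OF that(1,2) nz(2)] by blast
    from that(1) Cons.prems(1) that(2) nz(1) show False
    proof (cases rule: walk_step)
      case left
      then have "c div k = i" using that Cons.prems by simp
      then show False using left reach Cons.prems by (cases "is_x l") auto
    qed (use that Cons.prems in auto)
  qed
  have "B l r c * act n B u target c = B' l r c * act n B' u target c" if c: "c < n" for c
  proof (cases "i < c div k")
    case True
    show ?thesis
    proof (cases "B l r c = 0")
      case False
      have "word_degree_x u + dg (c div k) < 2 * dg i"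
        using B(1) Cons.prems(1) c False
      proof (cases rule: walk_step)
        case stay
        then show ?thesis using Cons.prems by simp
      next
        case right
        then show ?thesis using Cons.prems by (cases "is_x l") auto
      next
        case left
        then show ?thesis using Cons.prems by (cases "is_x l") auto
      qed
      then show ?thesis using Cons.IH[OF c True] same[OF Cons.prems(1) c Cons.prems(2) True] by simp
    qed (use same[OF Cons.prems(1) c Cons.prems(2) True] in simp)
  next
    case False
    then have "c div k \<le> i" by simp
    from cut[OF B(1) c this] cut[OF B(2) c this] show ?thesis by (rule trans[OF _ sym])
  qed
  then show ?case by simp
qed simp

end

lemma edge_cong:
  assumes "a < length ws \<Longrightarrow> ws ! a = l \<Longrightarrow> f a = g a" "b < length ws \<Longrightarrow> ws ! b = l \<Longrightarrow> f b = g b"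
  shows "edge ws f l a b = edge ws g l a b"
  unfolding edge_def using assms by (intro if_cong refl) blast+

lemma edge_mean:
  "edge ws (\<lambda>m. (f m + g m) / 2) l a b = (edge ws f l a b + edge ws g l a b) / 2"
proof (cases "b = Suc a \<and> a < length ws \<and> ws ! a = l")
  case True
  then show ?thesis by (simp add: edge_def)
next
  case False
  show ?thesis unfolding edge_def if_not_P[OF False] by simp
qed

lemma psd_zero_diagonal:
  assumes "P \<in> carrier_mat n n" "psd P" "r < n" "c < n" "c \<noteq> r" "P $$ (c, c) = 0"
  shows "P $$ (r, c) = 0"
proof -
  have P: "\<forall>r<n. \<forall>c<n. P $$ (r, c) = P $$ (c, r)" "\<And>y. 0 \<le> quad_form {..<n} (\<lambda>r c. P $$ (r, c)) y"
    using assms(1,2) psd_iff_quad_form by blast+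
  have "P $$ (c, r) = 0"
    by (rule quad_form_nonneg_zero_diagonal[of "{..<n}" c r "\<lambda>r c. P $$ (r, c)"]) (use P assms in auto)
  then show ?thesis using P(1) assms by simp
qed

text \<open>The positions \<open>i\<close> and \<open>j\<close> of the first two letters of degree one.\<close>

lemma word_degree_ge_2_split:
  assumes "2 \<le> word_degree_x w"
  obtains i j where "i < j" "j < length w" "is_x (w ! i)" "is_x (w ! j)"
    "word_degree_x (drop j w) = word_degree_x w - 1"
proof -
  have pos: "\<exists>x\<in>set w. is_x x" if "0 < word_degree_x w" for w :: "'a letter list"
    using that by (auto simp: word_degree_x_def filter_empty_conv)
  have zero: "word_degree_x u = 0" if "\<forall>y\<in>set u. \<not> is_x y" for u :: "'a letter list"
    using that by (simp add: word_degree_x_def filter_empty_conv)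
  obtain u x w' where w: "w = u @ x # w'" "is_x x" "\<forall>y\<in>set u. \<not> is_x y"
    using split_list_first_prop[OF pos[of w]] assms by auto
  have "0 < word_degree_x w'" using assms w zero[of u] by simp
  then obtain m x' v where w': "w' = m @ x' # v" "is_x x'" "\<forall>y\<in>set m. \<not> is_x y"
    using split_list_first_prop[OF pos[of w']] by auto
  show ?thesis
    using w w' zero[of u] zero[of m]
    by (intro that[of "length u" "Suc (length u + length m)"]) (simp_all add: nth_append)
qed

text \<open>The edges at the first two \<open>x\<close>-positions \<open>i1 < i2\<close> get the weight \<open>z\<close>, all others a small
  number \<open>s\<close>. The points with \<open>z = s\<close> and \<open>z = - s\<close> have the point with \<open>z = 0\<close> as their midpoint. The
  word \<open>ws\<close> contributes a multiple of \<open>z\<^sup>2\<close> at the corner, which has a nonzero second difference, and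
  at the far end nothing depends on \<open>z\<close>.\<close>

lemma degree_x_le_2_if_convex:
  fixes U :: "nat \<Rightarrow> ('g::finite) mat_tuple set"
  assumes U: "nc_domain U" "open_domain U" "convex_in_x p (level_product sym_tuples U)"
    and X0: "k > 0" "X0 \<in> U k" and w: "w \<in> Poly_Mapping.keys p"
  shows "word_degree_x w \<le> 2"
proof (rule ccontr)
  assume deg_w: "\<not> word_degree_x w \<le> 2"
  define d where "d = Max (word_degree_x ` Poly_Mapping.keys p)"
  have d: "word_degree_x v \<le> d" if "v \<in> Poly_Mapping.keys p" for v
    using that by (simp add: d_def)
  have d3: "3 \<le> d" using d[OF w] deg_w by simp
  define T where "T = {v \<in> Poly_Mapping.keys p. word_degree_x v = d}"
  have "d \<in> word_degree_x ` Poly_Mapping.keys p" unfolding d_def using w by (intro Max_in) auto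
  then have T: "finite T" "T \<noteq> {}" by (auto simp: T_def)
  then have "Max (length ` T) \<in> length ` T" by (intro Max_in) auto
  then obtain ws where "ws \<in> T" and max: "length ws = Max (length ` T)" by auto
  have longest: "length v \<le> length ws" if "v \<in> T" for v
    unfolding max using T that by simp
  have ws: "ws \<in> Poly_Mapping.keys p" "word_degree_x ws = d"
    using \<open>ws \<in> T\<close> by (simp_all add: T_def)
  obtain i1 i2 where i: "i1 < i2" "i2 < length ws" "is_x (ws ! i1)" "is_x (ws ! i2)"
    "word_degree_x (drop i2 ws) = d - 1"
    using word_degree_ge_2_split[of ws] ws d3 by auto
  interpret path_walk ws k by standard (rule X0)
  have k0: "k > 0" by (rule X0)
  define Z where "Z = copies k X0 (Suc L)"
  have ZU: "Z \<in> U n" unfolding Z_def by (rule copies_in_domain[OF U(1) X0]) simp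
  have n0: "n > 0" using k0 by simp
  have Z: "Z \<in> sym_tuples n" using U(1) ZU n0 unfolding nc_domain_def by blast
  obtain \<epsilon> where \<epsilon>: "\<epsilon> > 0"
    "\<And>A X Y. A \<in> sym_tuples n \<Longrightarrow> X \<in> sym_tuples n \<Longrightarrow> Y \<in> sym_tuples n \<Longrightarrow>
      (\<And>j r c. r < n \<Longrightarrow> c < n \<Longrightarrow> \<bar>X j $$ (r, c) - Z j $$ (r, c)\<bar> < \<epsilon>) \<Longrightarrow>
      (\<And>j r c. r < n \<Longrightarrow> c < n \<Longrightarrow> \<bar>Y j $$ (r, c) - Z j $$ (r, c)\<bar> < \<epsilon>) \<Longrightarrow>
      psd (convexity_defect n p (1/2) A X Y)"
    using midpoint_convex_near[OF U n0 ZU] by blast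
  define s where "s = \<epsilon> / 2"
  have s: "0 < s" "s < \<epsilon>" using \<epsilon>(1) by (simp_all add: s_def)
  \<comment> \<open>edges of degree zero may have the weight \<open>s\<close> as well, since only a nonzero value matters\<close>
  define wt where "wt z m = (if m = i1 \<or> m = i2 then z else s)" for z m
  define E where "E z l r c = (if r mod k = c mod k then edge ws (wt z) l (r div k) (c div k) else 0)" for z l r c
  have E_swap: "E z l r c = E z l c r" for z l r c by (simp add: E_def edge_swap[of ws _ l "r div k"])
  have "\<bar>edge ws (wt z) l a b\<bar> \<le> s" if "\<bar>z\<bar> = s" for z l a b
    using that s by (simp add: edge_def wt_def)
  then have E_bound: "\<bar>E z l r c\<bar> \<le> s" if "\<bar>z\<bar> = s" for z l r c
    using that s(1) by (simp add: E_def)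
  have "edge ws (wt 0) l a b = (edge ws (wt s) l a b + edge ws (wt (- s)) l a b) / 2" for l a b
  proof -
    have "wt 0 = (\<lambda>m. (wt s m + wt (- s) m) / 2)" by (rule ext) (simp add: wt_def)
    then show ?thesis by (simp only: edge_mean)
  qed
  then have E_mid: "E 0 l r c = (E s l r c + E (- s) l r c) / 2" for l r c
    by (simp add: E_def)
  have edge_a: "edge ws (wt z) l a b = edge ws (wt s) l a b" if "\<not> is_x l" for z l a b
    by (rule edge_cong) (use that i in \<open>auto simp: wt_def\<close>)
  have E_a: "E z l r c = E s l r c" if "\<not> is_x l" for z l r c
    by (simp only: E_def edge_a[OF that, of z])
  have edge_right: "edge ws (wt z) l a b = edge ws (wt s) l a b" if "i2 < a" "i2 < b" for z l a b
    by (rule edge_cong) (use that i(1) in \<open>simp_all add: wt_def\<close>)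
  have E_right: "E z l r c = E s l r c" if "i2 < r div k" "i2 < c div k" for z l r c
    by (simp only: E_def edge_right[OF that, of z])
  define A :: "'g mat_tuple" where "A j = mat n n (\<lambda>(r, c). E s (VarA j) r c)" for j
  define X where "X z j = mat n n (\<lambda>(r, c). Z j $$ (r, c) + E z (VarX j) r c)" for z j
  have A: "A \<in> sym_tuples n"
    by (rule sym_tuplesI) (auto simp: A_def E_swap simp del: mult_Suc)
  have X: "X z \<in> sym_tuples n" for z
    using sym_tuples_swap[OF Z] E_swap by (intro sym_tuplesI) (auto simp: X_def simp del: mult_Suc)
  have mid: "tuple_comb (1/2) (X s) (X (- s)) = X 0"
  proof (intro ext eq_matI)
    fix j r c assume "r < dim_row (X 0 j)" "c < dim_col (X 0 j)"
    then have "r < n" "c < n" by (simp_all add: X_def)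
    then show "tuple_comb (1/2) (X s) (X (- s)) j $$ (r, c) = X 0 j $$ (r, c)"
      unfolding tuple_comb_entry[OF X X \<open>r < n\<close> \<open>c < n\<close>]
      by (simp add: X_def E_mid field_simps del: mult_Suc)
  qed (simp_all add: tuple_comb_def X_def)
  define D where "D = convexity_defect n p (1/2) A (X s) (X (- s))"
  have psd_D: "psd D"
  proof -
    have "\<bar>E z l r c\<bar> < \<epsilon>" if "\<bar>z\<bar> = s" for z l r c
      using E_bound[OF that] s(2) by (rule le_less_trans)
    then show ?thesis
      unfolding D_def using s(1) by (intro \<epsilon>(2) A X) (simp_all add: X_def del: mult_Suc)
  qed
  define B where "B z = letter_entry A (X z)" for z
  have B: "walk_kernel (B z) (wt z)" for z
  proof -
    have "B z l r c = E z l r c" if rc: "r < n" "c < n" "r div k \<noteq> c div k \<or> \<not> is_x l" for l r c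
    proof (cases l)
      case (VarA j)
      then show ?thesis using rc E_a[of l z r c] by (simp add: B_def letter_entry_def A_def del: mult_Suc)
    next
      case (VarX j)
      then show ?thesis
        using rc by (simp add: B_def letter_entry_def X_def Z_def copies_def del: mult_Suc)
    qed
    then show ?thesis unfolding walk_kernel_def E_def by blast
  qed
  have B_right: "B z l r c = B s l r c" if "r < n" "c < n" "i2 < r div k" "i2 < c div k" for z l r c
    using that E_right[OF that(3,4), of z]
    by (cases l) (simp_all add: B_def letter_entry_def A_def X_def del: mult_Suc)
  \<comment> \<open>the index of \<open>target\<close>; the index \<open>0\<close> is the same vector at the left end\<close>
  define c where "c = L * k"
  have c: "c < n" "0 < n" "c \<noteq> 0" "c div k = L" using k0 i by (auto simp: c_def)
  have target: "target = (\<lambda>r. if r = c then 1 else 0)" by (rule ext) (simp add: target_def c_def)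
  have entry: "D $$ (r, c) = (\<Sum>v\<in>Poly_Mapping.keys p. Poly_Mapping.lookup p v *
      (1/2 * act n (B s) v target r + 1/2 * act n (B (- s)) v target r - act n (B 0) v target r))"
    if "r < n" for r
    unfolding D_def convexity_defect_entry[OF A X X that c(1)] word_defect_def mid B_def target
    by simp
  have "D $$ (c, c) = 0"
  proof -
    have same: "act n (B z) v target c = act n (B s) v target c" if "v \<in> Poly_Mapping.keys p" for z v
    proof (rule walk_back_local[OF B B B_right c(1)])
      show "i2 < c div k" using i c by simp
      show "word_degree_x v + dg (c div k) < 2 * dg i2"
        using d[OF that] d3 i(5) c(4) by (simp add: dg_def)
    qed
    show ?thesis
      unfolding entry[OF c(1)]
    proof (intro sum.neutral ballI)
      fix v assume "v \<in> Poly_Mapping.keys p"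
      note same[OF this, of "- s"] same[OF this, of 0]
      then show "Poly_Mapping.lookup p v * (1/2 * act n (B s) v target c
          + 1/2 * act n (B (- s)) v target c - act n (B 0) v target c) = 0"
        by simp
    qed
  qed
  then have "D $$ (0, c) = 0"
    using psd_zero_diagonal[of D n 0 c] psd_D c convexity_defect_carrier unfolding D_def by blast
  moreover have "D $$ (0, c) = Poly_Mapping.lookup p ws * (s\<^sup>2 * (\<Prod>m\<in>{..<L} - {i1} - {i2}. s))"
  proof -
    have prod: "(\<Prod>m<L. wt z m) = z\<^sup>2 * (\<Prod>m\<in>{..<L} - {i1} - {i2}. s)" for z
    proof -
      have "(\<Prod>m<L. wt z m) = wt z i1 * (wt z i2 * (\<Prod>m\<in>{..<L} - {i1} - {i2}. wt z m))"
        using i by (simp add: prod.remove[of "{..<L}" i1] prod.remove[of "{..<L} - {i1}" i2])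
      also have "(\<Prod>m\<in>{..<L} - {i1} - {i2}. wt z m) = (\<Prod>m\<in>{..<L} - {i1} - {i2}. s)"
        by (intro prod.cong refl) (simp add: wt_def)
      finally show ?thesis by (simp add: wt_def power2_eq_square mult.assoc)
    qed
    have walk: "act n (B z) v target 0 = (if v = ws then z\<^sup>2 * (\<Prod>m\<in>{..<L} - {i1} - {i2}. s) else 0)"
      if "v \<in> Poly_Mapping.keys p" for z v
      unfolding prod[symmetric]
    proof (rule walk_through[OF B])
      show "word_degree_x v \<le> word_degree_x ws" using d[OF that] ws by simp
      show "length v \<le> L" if "word_degree_x v = word_degree_x ws"
        using that \<open>v \<in> _\<close> ws longest[of v] by (simp add: T_def)
    qed
    have "D $$ (0, c) = (\<Sum>v\<in>Poly_Mapping.keys p.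
        if v = ws then Poly_Mapping.lookup p v * (s\<^sup>2 * (\<Prod>m\<in>{..<L} - {i1} - {i2}. s)) else 0)"
      unfolding entry[OF c(2)] by (intro sum.cong refl) (simp add: walk del: mult_Suc)
    then show ?thesis using ws by simp
  qed
  ultimately show False using ws(1) s by (simp add: in_keys_iff)
qed

section \<open>Sums of squares of polynomials\<close>

definition poly_of :: "'g letter list set \<Rightarrow> ('g letter list \<Rightarrow> real) \<Rightarrow> 'g ncpoly" where
  "poly_of V f = (\<Sum>v\<in>V. Poly_Mapping.single v (f v))"

lemma lookup_sum_single:
  "Poly_Mapping.lookup (\<Sum>v\<in>V. Poly_Mapping.single (g v) (f v)) w = (\<Sum>v\<in>V. if g v = w then f v else 0)"
  by (simp add: lookup_sum lookup_single when_def)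

lemma linear_in_x_poly_of:
  assumes "finite V" "\<And>v. v \<in> V \<Longrightarrow> word_degree_x v = 1"
  shows "linear_in_x (poly_of V f)"
  using assms by (auto simp: linear_in_x_def poly_of_def in_keys_iff lookup_sum_single split: if_splits)

lemma lookup_involution_times_poly_of:
  "Poly_Mapping.lookup (involution (poly_of V f) * poly_of V f) w = gram_coeff V (\<lambda>u v. f u * f v) w"
proof -
  have "involution (poly_of V f) = (\<Sum>v\<in>V. Poly_Mapping.single (rev v) (f v))"
  proof (rule poly_mapping_eqI)
    fix w :: "'a letter list"
    have "(v = rev w) = (rev v = w)" for v by auto
    then show "Poly_Mapping.lookup (involution (poly_of V f)) w
        = Poly_Mapping.lookup (\<Sum>v\<in>V. Poly_Mapping.single (rev v) (f v)) w"
      by (simp add: involution_def map_key.rep_eq poly_of_def lookup_sum_single)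
  qed
  then have "involution (poly_of V f) * poly_of V f
      = (\<Sum>u\<in>V. \<Sum>v\<in>V. Poly_Mapping.single (rev u @ v) (f u * f v))"
    by (simp add: poly_of_def sum_product mult_single plus_list_def)
  then show ?thesis
    by (simp add: lookup_sum lookup_single when_def gram_coeff_def)
qed

lemma lookup_gram:
  "Poly_Mapping.lookup (gram (map (\<lambda>i. poly_of V (q i)) [0..<N])) w
    = (\<Sum>i<N. gram_coeff V (\<lambda>u v. q i u * q i v) w)"
  by (simp add: gram_def o_def interv_sum_list_conv_sum_set_nat lookup_sum
      lookup_involution_times_poly_of atLeast0LessThan)

text \<open>A square evaluates to a squared norm, since \<open>\<langle>rev u v y, y\<rangle> = \<langle>v y, u y\<rangle>\<close> for symmetric matrices.\<close>

lemma sum_gram_coeff_act_nonneg: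
  assumes V: "finite V" and B: "\<And>l r c. r < n \<Longrightarrow> c < n \<Longrightarrow> B l r c = B l c r"
  shows "0 \<le> (\<Sum>w\<in>gram_words V. (\<Sum>r<n. y r * act n B w y r) * gram_coeff V (\<lambda>u v. f u * f v) w)"
proof -
  have adj: "(\<Sum>r<n. y r * act n B (rev u) (act n B v y) r) = (\<Sum>r<n. act n B u y r * act n B v y r)" for u v
    using act_adjoint[of n B y "rev u" "act n B v y"] B by simp
  have "(\<Sum>w\<in>gram_words V. (\<Sum>r<n. y r * act n B w y r) * gram_coeff V (\<lambda>u v. f u * f v) w)
      = (\<Sum>u\<in>V. \<Sum>v\<in>V. (\<Sum>r<n. act n B u y r * act n B v y r) * (f u * f v))"
    unfolding sum_gram_coeff[OF V] act_append adj ..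
  also have "\<dots> = (\<Sum>u\<in>V. \<Sum>r<n. \<Sum>v\<in>V. (f u * act n B u y r) * (f v * act n B v y r))"
    unfolding sum_distrib_right
    by (rule sum.cong[OF refl], subst sum.swap) (intro sum.cong refl, simp add: mult_ac)
  also have "\<dots> = (\<Sum>r<n. (\<Sum>u\<in>V. f u * act n B u y r)\<^sup>2)"
    by (subst sum.swap) (simp add: power2_eq_square sum_product)
  also have "\<dots> \<ge> 0" by (intro sum_nonneg) simp
  finally show ?thesis .
qed

section \<open>The sum of squares representation\<close>

definition words_upto :: "nat set \<Rightarrow> nat \<Rightarrow> 'g letter list set" where
  "words_upto D K = {w. word_degree_x w \<in> D \<and> length w \<le> K}"

lemma finite_words_upto [simp]: "finite (words_upto D K :: ('g::finite) letter list set)"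
proof -
  have "(UNIV :: 'g letter set) = VarA ` UNIV \<union> VarX ` UNIV"
  proof (intro equalityI subsetI)
    show "x \<in> range VarA \<union> range VarX" for x :: "'g letter" by (cases x) auto
  qed simp
  then have "finite (UNIV :: 'g letter set)" by (metis finite_UnI finite_imageI finite_UNIV)
  then have "finite {w :: 'g letter list. set w \<subseteq> UNIV \<and> length w \<le> K}"
    by (rule finite_lists_length_le)
  then show ?thesis by (rule rev_finite_subset) (auto simp: words_upto_def)
qed

text \<open>Cut in front of the second letter of degree one.\<close>

lemma degree_2_in_gram_words:
  assumes "word_degree_x w = 2" "length w \<le> K"
  shows "w \<in> gram_words (words_upto {1} K)"
proof -
  obtain j where "word_degree_x (drop j w) = 1"
    using word_degree_ge_2_split[of w] assms(1) by auto
  moreover have "word_degree_x (take j w) + word_degree_x (drop j w) = 2"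
    using assms(1) word_degree_x_simps(3)[of "take j w" "drop j w"] by simp
  ultimately show ?thesis
    using assms(2) unfolding gram_words_def words_upto_def
    by (intro image_eqI[of _ _ "(rev (take j w), drop j w)"]) auto
qed

lemma gram_words_degree: "w \<in> gram_words (words_upto {1} K) \<Longrightarrow> word_degree_x w = 2"
  by (auto simp: gram_words_def words_upto_def)

text \<open>A separating functional \<open>l\<close> lives on words of degree two, so on the words \<open>V'\<close> of degree at most one
  its form is that on the words \<open>V\<close> of degree one, extended by zero. It is nonnegative on \<open>V'\<close> and
  becomes definite by adding a small multiple \<open>\<epsilon>\<close> of the strictly positive functional. The words of
  degree at most one suffice for the Gelfand-Naimark-Segal construction, because a word of degree
  two is a product of two words of degree one. The matrices obtained have a size at which the
  domain has a point.\<close>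

lemma degree_two_part_sum_of_squares:
  fixes U :: "nat \<Rightarrow> ('g::finite) mat_tuple set" and p :: "'g ncpoly"
  assumes U: "nc_domain U" "open_domain U" "convex_in_x p (level_product sym_tuples U)"
    and X0: "k > 0" "X0 \<in> U k"
    and deg: "\<And>w. w \<in> Poly_Mapping.keys p \<Longrightarrow> word_degree_x w \<le> 2"
    and len: "\<And>w. w \<in> Poly_Mapping.keys p \<Longrightarrow> length w \<le> K"
    and rev: "\<And>w. Poly_Mapping.lookup p (rev w) = Poly_Mapping.lookup p w"
  obtains N :: nat and q where "\<And>w. w \<in> gram_words (words_upto {1} K) \<Longrightarrow>
    Poly_Mapping.lookup p w = (\<Sum>i<N. gram_coeff (words_upto {1} K) (\<lambda>u v. q i u * q i v) w)"
proof -
  define V where "V = (words_upto {1} K :: 'g letter list set)"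
  define V' where "V' = (words_upto {0, 1} K :: 'g letter list set)"
  have V: "finite V" "finite V'" by (simp_all add: V_def V'_def)
  have VV': "V \<subseteq> V'" by (auto simp: V_def V'_def words_upto_def)
  show ?thesis
  proof (rule sum_of_squares_or_separating_functional[of V "Poly_Mapping.lookup p"])
    show "finite V" by (rule V)
    show "Poly_Mapping.lookup p (rev w) = Poly_Mapping.lookup p w" for w by (rule rev)
  next
    fix q assume "\<And>w. w \<in> gram_words V \<Longrightarrow>
      Poly_Mapping.lookup p w = (\<Sum>i<card V. gram_coeff V (\<lambda>u v. q i u * q i v) w)"
    then show ?thesis unfolding V_def by (rule that)
  next
    fix l :: "'g letter list \<Rightarrow> real"
    assume l: "\<And>w. l (rev w) = l w" "\<And>w. w \<notin> gram_words V \<Longrightarrow> l w = 0"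
      "\<And>c. 0 \<le> quad_form V (\<lambda>u v. l (rev u @ v)) c"
      "(\<Sum>w\<in>gram_words V. l w * Poly_Mapping.lookup p w) < 0" (is "?S0 < 0")
    define pal where "pal = (pal_weight (2 * real (card V')) :: 'g letter list \<Rightarrow> real)"
    define S1 where "S1 = (\<Sum>w\<in>gram_words V. pal w * Poly_Mapping.lookup p w)"
    \<comment> \<open>so small that the perturbed functional is still negative on \<open>p\<close>\<close>
    define \<epsilon> where "\<epsilon> = - ?S0 / (\<bar>S1\<bar> + 1)"
    have abs1: "0 < \<bar>S1\<bar> + 1" by simp
    have \<epsilon>: "0 < \<epsilon>" using l(4) unfolding \<epsilon>_def by (intro divide_pos_pos abs1) simp
    have "\<epsilon> * S1 \<le> \<epsilon> * \<bar>S1\<bar>" using \<epsilon> by (simp add: mult_left_mono)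
    also have "\<dots> < \<epsilon> * (\<bar>S1\<bar> + 1)" using \<epsilon> by simp
    also have "\<dots> = - ?S0"
    proof -
      have "x / (\<bar>S1\<bar> + 1) * (\<bar>S1\<bar> + 1) = x" for x using abs1 by simp
      then show ?thesis unfolding \<epsilon>_def .
    qed
    finally have neg: "?S0 + \<epsilon> * S1 < 0" by simp
    define l' where "l' w = l w + \<epsilon> * pal w" for w
    have l'_pos: "0 < quad_form V' (\<lambda>u v. l' (rev u @ v)) c" if "u \<in> V'" "c u \<noteq> 0" for c u
    proof -
      have "quad_form V' (\<lambda>u v. l (rev u @ v)) c = quad_form V (\<lambda>u v. l (rev u @ v)) c"
      proof -
        have supp: "u \<in> V \<and> v \<in> V" if uv: "u \<in> V'" "v \<in> V'" "l (rev u @ v) \<noteq> 0" for u v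
        proof -
          have "word_degree_x (rev u @ v) = 2"
            using l(2) uv(3) gram_words_degree unfolding V_def by blast
          then show ?thesis using uv(1,2) by (auto simp: V_def V'_def words_upto_def)
        qed
        have "quad_form V' (\<lambda>u v. l (rev u @ v)) c
            = (\<Sum>(u, v)\<in>V' \<times> V'. c u * c v * l (rev u @ v))"
          by (simp add: quad_form_def sum.cartesian_product)
        also have "\<dots> = (\<Sum>(u, v)\<in>V \<times> V. c u * c v * l (rev u @ v))"
          using V VV' by (intro sum.mono_neutral_right) (auto dest: supp)
        finally show ?thesis by (simp add: quad_form_def sum.cartesian_product)
      qed
      moreover have "0 < quad_form V' (\<lambda>u v. pal (rev u @ v)) c"
      proof -
        have "0 < (\<Sum>u\<in>V'. (c u)\<^sup>2)" using V that by (intro sum_pos2[of _ u]) auto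
        then show ?thesis
          using pal_weight_strictly_positive[OF V(2) refl, of c] unfolding pal_def by linarith
      qed
      moreover have "quad_form V' (\<lambda>u v. l' (rev u @ v)) c
          = quad_form V' (\<lambda>u v. l (rev u @ v)) c + \<epsilon> * quad_form V' (\<lambda>u v. pal (rev u @ v)) c"
        by (simp add: quad_form_def l'_def sum.distrib[symmetric] sum_distrib_left algebra_simps)
      ultimately show ?thesis using l(3)[of c] \<epsilon> by (simp add: add_nonneg_pos)
    qed
    define n where "n = card V' * k"
    have nil: "[] \<in> V'" by (simp add: V'_def words_upto_def)
    then have "0 < card V'" using V by (auto simp: card_gt_0_iff)
    then have Z: "copies k X0 (card V') \<in> U n" and n: "n > 0" "card V' \<le> n"
      unfolding n_def using X0 by (simp_all add: copies_in_domain[OF U(1)])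
    obtain B e where B: "\<And>x r c. B x r c = B x c r"
      and e: "\<And>w1 w2. rev w1 \<in> V' \<Longrightarrow> w2 \<in> V' \<Longrightarrow>
        (\<Sum>r<n. e r * act n B (w1 @ w2) e r) = l' (w1 @ w2)"
    proof (rule truncated_gns[of V' l' n])
      show "w \<in> V'" if "x # w \<in> V'" for x w
        using that by (auto simp: V'_def words_upto_def split: if_splits)
      show "l' (rev w) = l' w" for w by (simp add: l'_def l(1) pal_def pal_weight_rev)
    qed (use V nil l'_pos n in blast)+
    define A :: "'g mat_tuple" where "A j = mat n n (\<lambda>(r, c). B (VarA j) r c)" for j
    define H :: "'g mat_tuple" where "H j = mat n n (\<lambda>(r, c). B (VarX j) r c)" for j
    have AH: "A \<in> sym_tuples n" "H \<in> sym_tuples n"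
      using B by (auto intro!: sym_tuplesI simp: A_def H_def)
    have moment: "(\<Sum>r<n. e r * act n (letter_entry A H) w e r) = l' w" if w: "w \<in> gram_words V" for w
    proof -
      have "letter_entry A H x r c = B x r c" if "r < n" "c < n" for x r c
        using that by (cases x) (simp_all add: letter_entry_def A_def H_def)
      then have "act n (letter_entry A H) w e r = act n B w e r" if "r < n" for r
        using that by (intro act_cong) auto
      moreover have "(\<Sum>r<n. e r * act n B w e r) = l' w"
      proof -
        obtain u v where "w = rev u @ v" "u \<in> V" "v \<in> V" using w by (auto simp: gram_words_def)
        then show ?thesis using VV' e[of "rev u" v] by auto
      qed
      ultimately show ?thesis by simp
    qed
    have "0 \<le> (\<Sum>w\<in>{w \<in> Poly_Mapping.keys p. word_degree_x w = 2}.
        Poly_Mapping.lookup p w * (\<Sum>r<n. e r * act n (letter_entry A H) w e r))"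
      by (rule degree_two_part_nonneg[OF U n(1) Z deg AH])
    also have "\<dots> = (\<Sum>w\<in>gram_words V. Poly_Mapping.lookup p w * (\<Sum>r<n. e r * act n (letter_entry A H) w e r))"
      using V degree_2_in_gram_words len gram_words_degree unfolding V_def
      by (intro sum.mono_neutral_left) (auto simp: in_keys_iff)
    also have "\<dots> = ?S0 + \<epsilon> * S1"
      by (simp add: moment l'_def S1_def sum_distrib_left sum.distrib[symmetric] algebra_simps)
    finally show ?thesis using neg by simp
  qed
qed

theorem theorem1p5:
  fixes p :: "('g::finite) ncpoly"
    and U :: "nat \<Rightarrow> 'g mat_tuple set"
  assumes "symmetric_poly p"
    and "nc_domain U" and "nonempty_domain U" and "open_domain U"
    and "convex_in_x p (level_product sym_tuples U)"
  shows "(\<exists>L \<Lambda>. p = L + gram \<Lambda> \<and> (\<forall>q\<in>set \<Lambda>. linear_in_x q) \<and> degree_x L \<le> 1)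
    \<and> degree_x p \<le> 2
    \<and> (\<forall>n>0. \<forall>A\<in>sym_tuples n. \<forall>X\<in>sym_tuples n. \<forall>Y\<in>sym_tuples n. \<forall>t::real. 0 < t \<and> t < 1 \<longrightarrow>
         t \<cdot>\<^sub>m eval_poly n p A X + (1 - t) \<cdot>\<^sub>m eval_poly n p A Y
           \<succeq> eval_poly n p A (tuple_comb t X Y))"
proof -
  obtain k X0 where X0: "k > 0" "X0 \<in> U k" using assms(3) by (auto simp: nonempty_domain_def)
  have deg: "word_degree_x w \<le> 2" if "w \<in> Poly_Mapping.keys p" for w
    using degree_x_le_2_if_convex[OF assms(2,4,5) X0 that] .
  define K where "K = Max (insert 0 (length ` Poly_Mapping.keys p))"
  have len: "length w \<le> K" if "w \<in> Poly_Mapping.keys p" for w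
    unfolding K_def using that by (intro Max_ge) auto
  define V where "V = (words_upto {1} K :: 'g letter list set)"
  have V: "finite V" by (simp add: V_def)
  obtain N :: nat and q where q: "\<And>w. w \<in> gram_words V \<Longrightarrow>
      Poly_Mapping.lookup p w = (\<Sum>i<N. gram_coeff V (\<lambda>u v. q i u * q i v) w)"
    using degree_two_part_sum_of_squares[OF assms(2,4,5) X0 deg len lookup_rev_symmetric[OF assms(1)]]
    unfolding V_def by blast
  define \<Lambda> where "\<Lambda> = map (\<lambda>i. poly_of V (q i)) [0..<N]"
  have in_V: "w \<in> gram_words V" if "w \<in> Poly_Mapping.keys p" "word_degree_x w = 2" for w
    using degree_2_in_gram_words[OF that(2) len[OF that(1)]] by (simp add: V_def)
  have L: "word_degree_x w \<le> 1" if "w \<in> Poly_Mapping.keys (p - gram \<Lambda>)" for w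
  proof (rule ccontr)
    assume "\<not> word_degree_x w \<le> 1"
    then have "w \<in> gram_words V \<or> w \<notin> Poly_Mapping.keys p"
      using deg[of w] in_V[of w] by linarith
    moreover have "Poly_Mapping.lookup p w = Poly_Mapping.lookup (gram \<Lambda>) w" if "w \<in> gram_words V"
      using q[OF that] by (simp add: \<Lambda>_def lookup_gram)
    moreover have "Poly_Mapping.lookup (gram \<Lambda>) w = 0" if "w \<notin> gram_words V"
      using gram_coeff_outside[OF that] by (simp add: \<Lambda>_def lookup_gram)
    ultimately show False
      using that by (cases "w \<in> gram_words V") (auto simp: in_keys_iff lookup_minus)
  qed
  have "p = (p - gram \<Lambda>) + gram \<Lambda>" by simp
  moreover have "linear_in_x (poly_of V f)" for f
    by (rule linear_in_x_poly_of[OF V]) (simp add: V_def words_upto_def)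
  then have "\<forall>r\<in>set \<Lambda>. linear_in_x r" by (auto simp: \<Lambda>_def)
  moreover have "degree_x (p - gram \<Lambda>) \<le> 1"
    using L by (auto simp: degree_x_def)
  ultimately have decomposition:
    "\<exists>L \<Lambda>. p = L + gram \<Lambda> \<and> (\<forall>q\<in>set \<Lambda>. linear_in_x q) \<and> degree_x L \<le> 1" by blast
  have "t \<cdot>\<^sub>m eval_poly n p A X + (1 - t) \<cdot>\<^sub>m eval_poly n p A Y \<succeq> eval_poly n p A (tuple_comb t X Y)"
    if A: "A \<in> sym_tuples n" and X: "X \<in> sym_tuples n" and Y: "Y \<in> sym_tuples n"
      and t: "0 < t" "t < 1" for n A X Y and t :: real
    unfolding loewner_ge_comb_iff[OF A X Y assms(1)] convexity_defect_quad_form[OF A X Y]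
  proof
    fix y :: "nat \<Rightarrow> real"
    define B where "B = letter_entry A (\<lambda>j. X j - Y j)"
    have B: "B l r c = B l c r" if "r < n" "c < n" for l r c
      using that A X Y by (cases l) (auto simp: B_def letter_entry_def sym_tuples_swap[of _ n r c])
    have "(\<Sum>w\<in>Poly_Mapping.keys p. Poly_Mapping.lookup p w * (\<Sum>r<n. y r * word_defect n t A X Y w y r))
        = (\<Sum>w\<in>Poly_Mapping.keys p. if word_degree_x w = 2 then
            t * (1 - t) * (Poly_Mapping.lookup p w * (\<Sum>r<n. y r * act n B w y r)) else 0)"
      using word_defect_degree_le_2[OF A X Y deg]
      by (intro sum.cong refl) (simp add: B_def sum_distrib_left mult_ac)
    also have "\<dots> = (\<Sum>w\<in>gram_words V.
        t * (1 - t) * (Poly_Mapping.lookup p w * (\<Sum>r<n. y r * act n B w y r)))"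
      unfolding sum.inter_filter[OF finite_keys, symmetric]
      using V in_V gram_words_degree by (intro sum.mono_neutral_left) (auto simp: in_keys_iff V_def)
    also have "\<dots> = t * (1 - t) * (\<Sum>i<N. \<Sum>w\<in>gram_words V.
        (\<Sum>r<n. y r * act n B w y r) * gram_coeff V (\<lambda>u v. q i u * q i v) w)"
    proof -
      have "(\<Sum>w\<in>gram_words V. Poly_Mapping.lookup p w * (\<Sum>r<n. y r * act n B w y r))
          = (\<Sum>w\<in>gram_words V. \<Sum>i<N. (\<Sum>r<n. y r * act n B w y r) * gram_coeff V (\<lambda>u v. q i u * q i v) w)"
        unfolding sum_distrib_left[symmetric] by (intro sum.cong refl) (simp add: q mult.commute)
      also have "\<dots> = (\<Sum>i<N. \<Sum>w\<in>gram_words V.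
          (\<Sum>r<n. y r * act n B w y r) * gram_coeff V (\<lambda>u v. q i u * q i v) w)"
        by (rule sum.swap)
      finally show ?thesis by (simp add: sum_distrib_left[symmetric])
    qed
    also have "\<dots> \<ge> 0"
      using t B by (intro mult_nonneg_nonneg sum_nonneg sum_gram_coeff_act_nonneg V) auto
    finally show "0 \<le> (\<Sum>w\<in>Poly_Mapping.keys p.
      Poly_Mapping.lookup p w * (\<Sum>r<n. y r * word_defect n t A X Y w y r))" .
  qed
  moreover have "degree_x p \<le> 2" using deg by (auto simp: degree_x_def)
  ultimately show ?thesis using decomposition by blast
qed

end
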